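(* Let $N\ge2$, $p>1$, $\beta\in\mathbb{R}\setminus\{0\}$ and $\omega>\frac{N^2}{\beta^2}$. Set $$d_\omega^{\mathrm{eq}}=\inf\{S_\omega(v):\ v\in H^1_{\mathrm{eq}}(\Gamma)\setminus\{0\},\ I_\omega(v)=0\}.$$ Then $d_\omega^{\mathrm{eq}}=S_\omega(\phi_\beta)$, where $\phi_\beta=(\tilde\phi_\beta)_{j=1}^N$ is the function on $\Gamma$ all of whose components equal $$\tilde\phi_\beta(x)=\left[\frac{(p+1)\omega}{2}\,\mathrm{sech}^2\Big(\frac{(p-1)\sqrt\omega}{2}x-\tanh^{-1}\Big(\frac{N}{\beta\sqrt\omega}\Big)\Big)\right]^{\frac1{p-1}}.$$
   Context: $\Gamma$ is the star graph with $N\ge2$ half-lines $(0,\infty)$ joined at the vertex $0$. A function on $\Gamma$ is $v=(v_j)_{j=1}^N$ with $v_j:(0,\infty)\to\mathbb{C}$. $L^q(\Gamma)=\bigoplus_{j=1}^N L^q(\mathbb{R}^+)$ with norm $\|\cdot\|_q$, $H^1(\Gamma)=\bigoplus_{j=1}^N H^1(\mathbb{R}^+)$ (no continuity condition at the vertex), and $H^1_{\mathrm{eq}}(\Gamma)=\{v\in H^1(\Gamma):v_1(x)=\dots=v_N(x),\ x>0\}$. For $v\in H^1(\Gamma)$, $$F_\beta(v)=\|v'\|_2^2+\frac1\beta\Big|\sum_{j=1}^Nv_j(0)\Big|^2,\quad S_\omega(v)=\tfrac12F_\beta(v)+\tfrac\omega2\|v\|_2^2-\tfrac1{p+1}\|v\|_{p+1}^{p+1},\quad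 I_\omega(v)=F_\beta(v)+\omega\|v\|_2^2-\|v\|_{p+1}^{p+1}.$$ *)

theory Defs
  imports "HOL-Analysis.Analysis"
begin

text \<open>
  Functions on the half-line are represented by total functions on the reals of which only the
  values on \<open>(0,\<infinity>)\<close> matter, up to null sets. A function on the star graph with \<open>N\<close> edges is
  a family \<open>v :: nat \<Rightarrow> real \<Rightarrow> complex\<close> of which only the components \<open>v 1, \<dots>, v N\<close> matter.
\<close>

abbreviation half_line :: "real measure" where
  "half_line \<equiv> lebesgue_on {0<..}"

definition L2_half :: "(real \<Rightarrow> complex) set" where
  "L2_half = {f. f \<in> borel_measurable half_line \<and> integrable half_line (\<lambda>x. (cmod (f x))\<^sup>2)}"

text \<open>Test functions: the elements of \<open>C\<^sub>c\<^sup>\<infinity>(0,\<infinity>)\<close>, extended by zero to the real line.\<close>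

definition test_function :: "(real \<Rightarrow> real) \<Rightarrow> bool" where
  "test_function \<psi> \<longleftrightarrow>
     (\<forall>k x. ((deriv ^^ k) \<psi>) differentiable (at x)) \<and>
     compact (closure {x. \<psi> x \<noteq> 0}) \<and> closure {x. \<psi> x \<noteq> 0} \<subseteq> {0<..}"

definition has_weak_deriv :: "(real \<Rightarrow> complex) \<Rightarrow> (real \<Rightarrow> complex) \<Rightarrow> bool" where
  "has_weak_deriv f g \<longleftrightarrow>
     (\<forall>\<psi>. test_function \<psi> \<longrightarrow>
        (LINT x|half_line. deriv \<psi> x *\<^sub>R f x) = - (LINT x|half_line. \<psi> x *\<^sub>R g x))"

definition H1_half :: "(real \<Rightarrow> complex) set" where
  "H1_half = {f \<in> L2_half. \<exists>g\<in>L2_half. has_weak_deriv f g}"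

text \<open>For \<open>f\<close> in \<open>H1_half\<close> the weak derivative is unique up to null sets.\<close>

definition weak_deriv :: "(real \<Rightarrow> complex) \<Rightarrow> real \<Rightarrow> complex" where
  "weak_deriv f = (SOME g. g \<in> L2_half \<and> has_weak_deriv f g)"

text \<open>The boundary value \<open>f(0)\<close> is that of the representative continuous on \<open>[0,\<infinity>)\<close>.\<close>

definition trace0 :: "(real \<Rightarrow> complex) \<Rightarrow> complex" where
  "trace0 f = (THE c. \<exists>u. continuous_on {0..} u \<and> (AE x in half_line. f x = u x) \<and> u 0 = c)"

definition star_norm :: "nat \<Rightarrow> real \<Rightarrow> (nat \<Rightarrow> real \<Rightarrow> complex) \<Rightarrow> real" where
  "star_norm N q v = (\<Sum>j=1..N. LINT x|half_line. cmod (v j x) powr q) powr (1 / q)"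

definition H1_star :: "nat \<Rightarrow> (nat \<Rightarrow> real \<Rightarrow> complex) set" where
  "H1_star N = {v. \<forall>j\<in>{1..N}. v j \<in> H1_half}"

definition H1_eq :: "nat \<Rightarrow> (nat \<Rightarrow> real \<Rightarrow> complex) set" where
  "H1_eq N = {v \<in> H1_star N. \<forall>i\<in>{1..N}. \<forall>j\<in>{1..N}. AE x in half_line. v i x = v j x}"

definition star_zero :: "nat \<Rightarrow> (nat \<Rightarrow> real \<Rightarrow> complex) \<Rightarrow> bool" where
  "star_zero N v \<longleftrightarrow> (\<forall>j\<in>{1..N}. AE x in half_line. v j x = 0)"

definition F_star :: "nat \<Rightarrow> real \<Rightarrow> (nat \<Rightarrow> real \<Rightarrow> complex) \<Rightarrow> real" where
  "F_star N \<beta> v =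
     (star_norm N 2 (\<lambda>j. weak_deriv (v j)))\<^sup>2 + 1 / \<beta> * (cmod (\<Sum>j=1..N. trace0 (v j)))\<^sup>2"

definition S_star :: "nat \<Rightarrow> real \<Rightarrow> real \<Rightarrow> real \<Rightarrow> (nat \<Rightarrow> real \<Rightarrow> complex) \<Rightarrow> real" where
  "S_star N p \<beta> \<omega> v =
     1 / 2 * F_star N \<beta> v + \<omega> / 2 * (star_norm N 2 v)\<^sup>2
       - 1 / (p + 1) * star_norm N (p + 1) v powr (p + 1)"

definition I_star :: "nat \<Rightarrow> real \<Rightarrow> real \<Rightarrow> real \<Rightarrow> (nat \<Rightarrow> real \<Rightarrow> complex) \<Rightarrow> real" where
  "I_star N p \<beta> \<omega> v =
     F_star N \<beta> v + \<omega> * (star_norm N 2 v)\<^sup>2 - star_norm N (p + 1) v powr (p + 1)"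

text \<open>
  The infimum is taken in the extended reals, so that equality with a real number includes that
  the constraint set is nonempty and the action is bounded below on it.
\<close>

definition d_eq :: "nat \<Rightarrow> real \<Rightarrow> real \<Rightarrow> real \<Rightarrow> ereal" where
  "d_eq N p \<beta> \<omega> =
     (INF v \<in> {v \<in> H1_eq N. \<not> star_zero N v \<and> I_star N p \<beta> \<omega> v = 0}. ereal (S_star N p \<beta> \<omega> v))"

definition sech :: "real \<Rightarrow> real" where
  "sech x = 1 / cosh x"

definition phi_tilde :: "nat \<Rightarrow> real \<Rightarrow> real \<Rightarrow> real \<Rightarrow> real \<Rightarrow> real" where
  "phi_tilde N p \<beta> \<omega> x =
     ((p + 1) * \<omega> / 2 *
       (sech ((p - 1) * sqrt \<omega> / 2 * x - artanh (real N / (\<beta> * sqrt \<omega>))))\<^sup>2) powr (1 / (p - 1))"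

definition phi_star :: "nat \<Rightarrow> real \<Rightarrow> real \<Rightarrow> real \<Rightarrow> nat \<Rightarrow> real \<Rightarrow> complex" where
  "phi_star N p \<beta> \<omega> = (\<lambda>j x. complex_of_real (phi_tilde N p \<beta> \<omega> x))"

end

theory Submission
  imports Defs "HOL-Computational_Algebra.Polynomial"
begin

text \<open>
  All edges carry the same function, so with \<open>\<gamma> = N / \<beta>\<close> both functionals are \<open>N\<close> times functionals of one
  function \<open>u\<close> on the half-line, and the hypothesis on \<open>\<omega>\<close> becomes \<open>\<gamma>\<^sup>2 < \<omega>\<close>. The action on one edge is
  \[ \frac12 \int_0^\infty (|u'|^2 + W(|u|))\, dx + \frac\gamma2 |u(0)|^2, \qquad
     W(s) = \omega s^2 - \frac{2}{p+1} s^{p+1}, \]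
  and for \<open>s \<ge> 0\<close> one has \<open>W s \<ge> 0\<close> exactly when \<open>s \<le> U\<close>, where \<open>U\<close> is the
  maximum of the soliton on the whole line. The proof is a calibration argument.

  With \<open>G' = sqrt W\<close>, \<open>G 0 = 0\<close>, the inequality \<open>2 a b \<le> a\<^sup>2 + b\<^sup>2\<close> gives, as long as \<open>|u| \<le> U\<close>,
  \[ \frac12 \int_a^b (|u'|^2 + W(|u|))\, dx \ge \int_a^b |u'| \sqrt{W(|u|)}\, dx \ge |G(|u(b)|) - G(|u(a)|)|. \]
  Since \<open>u\<close> takes arbitrarily small values near infinity, half the integral over the half-line is at least
  \<open>2 G(|u(x)|) - G(|u(0)|)\<close> for every \<open>x\<close>; this is \<open>profile_energy_bound\<close>.

  On the Nehari manifold the action of \<open>t u\<close> is largest at \<open>t = 1\<close>, so \<open>u\<close> may be replaced by any positive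
  multiple of itself. If \<open>\<gamma> \<ge> 0\<close>, scale \<open>u\<close> so that \<open>sup |u| = U\<close>: the action is at least
  \<open>2 G(U) - G(s) + \<gamma> s\<^sup>2 / 2\<close> with \<open>s = |u(0)|\<close>, and this function of \<open>s\<close> is smallest at the positive
  solution of \<open>sqrt (W s) = \<gamma> s\<close>, which is \<open>s = \<phi>(0)\<close>. If \<open>\<gamma> < 0\<close>, the same scaling
  works when it yields \<open>s \<le> \<phi>(0)\<close>; otherwise a smaller multiple has \<open>|u(0)| = \<phi>(0)\<close> and the action is at least \<open>G(\<phi>(0)) + \<gamma> \<phi>(0)\<^sup>2 / 2\<close>. This is
  \<open>half_action_lower_bound\<close>. The profile \<open>\<phi>\<close> satisfies \<open>(\<phi>')\<^sup>2 = W \<phi>\<close> and is monotone on either side of its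
  maximum, so every inequality is an equality for it (\<open>\<phi>_action\<close>), and it lies on the Nehari manifold because
  \<open>(\<phi> \<phi>')'\<close> is the density of the integral part of the Nehari functional (\<open>\<phi>_nehari\<close>).

  The analytic input is that a function with weak derivative \<open>g\<close> in \<open>L\<^sup>2\<close> agrees almost everywhere with a primitive
  of \<open>g\<close> (\<open>H1_representative\<close>), together with an inequality form of the chain rule for such primitives
  (\<open>chain_rule_bound\<close>).
\<close>

section \<open>Additive interval functions\<close>

text \<open>
  An additive interval function bounded near each point is bounded globally, by bisection. Both the chain rule
  and the product rule for primitives of integrable functions come from this principle.
\<close>

lemma interval_function_le_of_local:
  fixes F :: "real \<Rightarrow> real \<Rightarrow> 'a::real_normed_vector" and M :: "real \<Rightarrow> real \<Rightarrow> real"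
  assumes ab: "a \<le> b"
    and F: "\<And>x y z. \<lbrakk>a \<le> x; x \<le> y; y \<le> z; z \<le> b\<rbrakk> \<Longrightarrow> F x z = F x y + F y z"
    and M: "\<And>x y z. \<lbrakk>a \<le> x; x \<le> y; y \<le> z; z \<le> b\<rbrakk> \<Longrightarrow> M x z = M x y + M y z"
    and loc: "\<And>t. \<lbrakk>a \<le> t; t \<le> b\<rbrakk> \<Longrightarrow> \<exists>d>0. \<forall>x y. a \<le> x \<longrightarrow> x \<le> t \<longrightarrow> t \<le> y \<longrightarrow> y \<le> b \<longrightarrow> y - x < d \<longrightarrow>
                norm (F x y) \<le> M x y"
  shows "norm (F a b) \<le> M a b"
proof -
  define P where "P x y \<longleftrightarrow> (a \<le> x \<longrightarrow> x \<le> y \<longrightarrow> y \<le> b \<longrightarrow> norm (F x y) \<le> M x y)" for x y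
  have "P a b"
  proof (rule Bolzano[OF ab])
    fix x y z
    assume xy: "P x y" and yz: "P y z" and le: "x \<le> y" "y \<le> z"
    show "P x z"
      unfolding P_def
    proof (intro impI)
      assume xz: "a \<le> x" "x \<le> z" "z \<le> b"
      have "norm (F x z) \<le> norm (F x y) + norm (F y z)"
        using F[OF xz(1) le xz(3)] by (metis norm_triangle_ineq)
      also have "\<dots> \<le> M x y + M y z"
        using xy yz le xz unfolding P_def by (intro add_mono) auto
      finally show "norm (F x z) \<le> M x z"
        using M[OF xz(1) le xz(3)] by simp
    qed
  next
    fix t assume "a \<le> t" "t \<le> b"
    from loc[OF this] show "\<exists>d>0. \<forall>x y. x \<le> t \<and> t \<le> y \<and> y - x < d \<longrightarrow> P x y"
      unfolding P_def by blast
  qed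
  then show ?thesis using ab by (simp add: P_def)
qed

lemma absolutely_integrable_continuous_mult:
  fixes c :: "real \<Rightarrow> real" and g :: "real \<Rightarrow> 'b::euclidean_space"
  assumes "continuous_on {a..b} c" "g absolutely_integrable_on {a..b}"
  shows "(\<lambda>x. c x *\<^sub>R g x) absolutely_integrable_on {a..b}"
proof (rule absolutely_integrable_bounded_measurable_product[where h = "(*\<^sub>R)"])
  show "bilinear ((*\<^sub>R) :: real \<Rightarrow> 'b \<Rightarrow> 'b)"
    by (simp add: bilinear_def linear_iff algebra_simps)
  show "c \<in> borel_measurable (lebesgue_on {a..b})"
    using assms(1) by (intro continuous_imp_measurable_on_sets_lebesgue) auto
  show "bounded (c ` {a..b})"
    using assms(1) by (intro compact_imp_bounded compact_continuous_image) auto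
qed (use assms in auto)

text \<open>
  Here \<open>v\<close> is absolutely continuous with speed at most \<open>m\<close>. On a short interval \<open>w \<circ> v\<close> is nearly
  constant and the mean value theorem for \<open>G\<close> bounds the increment of \<open>G \<circ> v\<close> by that constant times \<open>\<integral> m\<close>.
\<close>

lemma chain_rule_bound:
  fixes v m G w :: "real \<Rightarrow> real"
  assumes ab: "a \<le> b"
    and m: "m absolutely_integrable_on {a..b}"
    and contv: "continuous_on {a..b} v"
    and inc: "\<And>x y. \<lbrakk>a \<le> x; x \<le> y; y \<le> b\<rbrakk> \<Longrightarrow> \<bar>v y - v x\<bar> \<le> integral {x..y} m"
    and m0: "\<And>x. x \<in> {a..b} \<Longrightarrow> 0 \<le> m x"
    and G: "\<And>s. (G has_real_derivative w s) (at s)"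
    and contw: "continuous_on UNIV w"
  shows "\<bar>G (v b) - G (v a)\<bar> \<le> integral {a..b} (\<lambda>x. \<bar>w (v x)\<bar> * m x)"
proof (rule field_le_epsilon)
  fix \<epsilon> :: real assume e: "\<epsilon> > 0"
  define J where "J = integral {a..b} m"
  have J0: "J \<ge> 0"
    unfolding J_def using m m0 by (intro integral_nonneg) (auto simp: absolutely_integrable_on_def)
  define e where "e = \<epsilon> / (J + 1)"
  have e0: "e > 0" using e J0 by (simp add: e_def)
  have contwv: "continuous_on {a..b} (\<lambda>x. \<bar>w (v x)\<bar>)"
    by (intro continuous_intros continuous_on_compose2[OF contw] contv) auto
  have iwm: "(\<lambda>x. \<bar>w (v x)\<bar> * m x) absolutely_integrable_on {a..b}"
    using absolutely_integrable_continuous_mult[OF contwv m] by simp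
  have iwem: "(\<lambda>x. (\<bar>w (v x)\<bar> + e) * m x) absolutely_integrable_on {a..b}"
    using absolutely_integrable_continuous_mult[OF continuous_on_add[OF contwv continuous_on_const] m] by simp
  have sub: "f integrable_on {x..y}"
    if "f absolutely_integrable_on {a..b}" "a \<le> x" "y \<le> b" for f :: "real \<Rightarrow> real" and x y
    using that absolutely_integrable_on_subinterval[of "{a..b}" f x y]
    by (auto simp: absolutely_integrable_on_def)
  have "norm (G (v b) - G (v a)) \<le> integral {a..b} (\<lambda>x. (\<bar>w (v x)\<bar> + e) * m x)"
  proof (rule interval_function_le_of_local[where F = "\<lambda>x y. G (v y) - G (v x)" and
        M = "\<lambda>x y. integral {x..y} (\<lambda>x. (\<bar>w (v x)\<bar> + e) * m x)", OF ab])
    show "integral {x..z} (\<lambda>x. (\<bar>w (v x)\<bar> + e) * m x) =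
       integral {x..y} (\<lambda>x. (\<bar>w (v x)\<bar> + e) * m x) + integral {y..z} (\<lambda>x. (\<bar>w (v x)\<bar> + e) * m x)"
      if "a \<le> x" "x \<le> y" "y \<le> z" "z \<le> b" for x y z
      using that sub[OF iwem, of x z] by (intro Henstock_Kurzweil_Integration.integral_combine[symmetric]) auto
  next
    fix t assume t: "a \<le> t" "t \<le> b"
    have "continuous_on {a..b} (\<lambda>x. w (v x))"
      by (intro continuous_on_compose2[OF contw] contv) auto
    then obtain d where d: "d > 0" "\<And>x. x \<in> {a..b} \<Longrightarrow> dist x t < d \<Longrightarrow> dist (w (v x)) (w (v t)) < e/2"
      unfolding continuous_on_iff using t e0 by (metis atLeastAtMost_iff half_gt_zero)
    show "\<exists>d>0. \<forall>x y. a \<le> x \<longrightarrow> x \<le> t \<longrightarrow> t \<le> y \<longrightarrow> y \<le> b \<longrightarrow> y - x < d \<longrightarrow>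
                norm (G (v y) - G (v x)) \<le> integral {x..y} (\<lambda>x. (\<bar>w (v x)\<bar> + e) * m x)"
    proof (intro exI[of _ d] conjI d(1) allI impI)
      fix x y assume xy: "a \<le> x" "x \<le> t" "t \<le> y" "y \<le> b" "y - x < d"
      have "\<exists>s\<in>{x..y}. \<bar>G (v y) - G (v x)\<bar> = \<bar>w (v s)\<bar> * \<bar>v y - v x\<bar>"
      proof (cases "v x = v y")
        case True then show ?thesis using xy by (intro bexI[of _ x]) auto
      next
        case False
        \<comment> \<open>the mean value theorem yields an intermediate value of \<open>v\<close>, which \<open>v\<close> attains\<close>
        from False have lt: "min (v x) (v y) < max (v x) (v y)" by auto
        obtain z where z: "min (v x) (v y) < z" "z < max (v x) (v y)"
          "G (max (v x) (v y)) - G (min (v x) (v y)) = (max (v x) (v y) - min (v x) (v y)) * w z"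
          using MVT2[OF lt, of G w] G by blast
        have con: "continuous_on {x..y} v"
          by (rule continuous_on_subset[OF contv]) (use xy in auto)
        have "\<exists>s. x \<le> s \<and> s \<le> y \<and> v s = z"
        proof (cases "v x \<le> v y")
          case True then show ?thesis using z con xy IVT'[of v x z y] by (auto simp: min_def max_def)
        next
          case False then show ?thesis using z con xy IVT2'[of v y z x] by (auto simp: min_def max_def)
        qed
        then obtain s where s: "s \<in> {x..y}" "v s = z" by auto
        have "\<bar>G (v y) - G (v x)\<bar> = \<bar>G (max (v x) (v y)) - G (min (v x) (v y))\<bar>"
          by (simp add: min_def max_def abs_minus_commute)
        also have "\<dots> = \<bar>w z\<bar> * \<bar>max (v x) (v y) - min (v x) (v y)\<bar>"
          unfolding z(3) by (simp add: abs_mult mult.commute)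
        also have "\<bar>max (v x) (v y) - min (v x) (v y)\<bar> = \<bar>v y - v x\<bar>"
          by (simp add: min_def max_def)
        finally show ?thesis using s by auto
      qed
      then obtain s where s: "s \<in> {x..y}" "\<bar>G (v y) - G (v x)\<bar> = \<bar>w (v s)\<bar> * \<bar>v y - v x\<bar>" by auto
      have "\<bar>w (v s)\<bar> * \<bar>v y - v x\<bar> \<le> \<bar>w (v s)\<bar> * integral {x..y} m"
        using inc[of x y] xy by (intro mult_left_mono) auto
      also have "\<dots> = integral {x..y} (\<lambda>r. \<bar>w (v s)\<bar> * m r)"
        by simp
      also have "\<dots> \<le> integral {x..y} (\<lambda>x. (\<bar>w (v x)\<bar> + e) * m x)"
      proof (rule integral_le)
        show "(\<lambda>r. \<bar>w (v s)\<bar> * m r) integrable_on {x..y}"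
          by (intro integrable_on_mult_right sub[OF m]) (use xy in auto)
        show "(\<lambda>x. (\<bar>w (v x)\<bar> + e) * m x) integrable_on {x..y}"
          using sub[OF iwem] xy by auto
        fix r assume r: "r \<in> {x..y}"
        have "dist (w (v q)) (w (v t)) < e/2" if "q \<in> {x..y}" for q
          by (rule d(2)) (use that xy in \<open>auto simp: dist_real_def\<close>)
        then have "dist (w (v s)) (w (v t)) < e/2" "dist (w (v r)) (w (v t)) < e/2"
          using s(1) r by auto
        then have "\<bar>w (v s)\<bar> \<le> \<bar>w (v r)\<bar> + e" unfolding dist_real_def by linarith
        then show "\<bar>w (v s)\<bar> * m r \<le> (\<bar>w (v r)\<bar> + e) * m r"
          using r xy by (intro mult_right_mono m0) auto
      qed
      finally show "norm (G (v y) - G (v x)) \<le> integral {x..y} (\<lambda>x. (\<bar>w (v x)\<bar> + e) * m x)"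
        using s by simp
    qed
  qed auto
  also have "\<dots> = integral {a..b} (\<lambda>x. \<bar>w (v x)\<bar> * m x + e * m x)"
    by (simp add: algebra_simps)
  also have "\<dots> = integral {a..b} (\<lambda>x. \<bar>w (v x)\<bar> * m x) + e * J"
    unfolding J_def using iwm m
    by (subst Henstock_Kurzweil_Integration.integral_add)
       (auto simp: absolutely_integrable_on_def intro!: integrable_on_mult_right)
  also have "e * J \<le> \<epsilon>"
    using e J0 by (simp add: e_def field_simps)
  finally show "\<bar>G (v b) - G (v a)\<bar> \<le> integral {a..b} (\<lambda>x. \<bar>w (v x)\<bar> * m x) + \<epsilon>" by simp
qed

text \<open>
  The defect of the formula is an additive interval function. On \<open>[x, y]\<close> it is
  \<open>\<integral> \<psi>' (u y - u) + (\<psi> x - \<psi>) g\<close>, which is small compared with \<open>\<integral> |\<psi>'| + |g|\<close> because \<open>u\<close> and \<open>\<psi>\<close> are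
  continuous.
\<close>

lemma integral_by_parts_primitive:
  fixes \<psi> \<psi>' :: "real \<Rightarrow> real" and u g :: "real \<Rightarrow> 'b::euclidean_space"
  assumes ab: "a \<le> b"
    and g: "g absolutely_integrable_on {a..b}"
    and contu: "continuous_on {a..b} u"
    and u: "\<And>x y. \<lbrakk>a \<le> x; x \<le> y; y \<le> b\<rbrakk> \<Longrightarrow> u y - u x = integral {x..y} g"
    and \<psi>: "\<And>x. (\<psi> has_real_derivative \<psi>' x) (at x)"
    and contd: "continuous_on {a..b} \<psi>'"
  shows "integral {a..b} (\<lambda>x. \<psi>' x *\<^sub>R u x) + integral {a..b} (\<lambda>x. \<psi> x *\<^sub>R g x) = \<psi> b *\<^sub>R u b - \<psi> a *\<^sub>R u a"
proof -
  have cont\<psi>: "continuous_on {a..b} \<psi>"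
    by (meson \<psi> DERIV_continuous continuous_at_imp_continuous_on)
  have i1: "(\<lambda>x. \<psi>' x *\<^sub>R u x) absolutely_integrable_on {a..b}"
    by (intro absolutely_integrable_continuous_real continuous_intros contd contu)
  have i2: "(\<lambda>x. \<psi> x *\<^sub>R g x) absolutely_integrable_on {a..b}"
    by (rule absolutely_integrable_continuous_mult[OF cont\<psi> g])
  have i3: "\<psi>' absolutely_integrable_on {a..b}"
    by (intro absolutely_integrable_continuous_real contd)
  have i4: "(\<lambda>x. \<bar>\<psi>' x\<bar> + norm (g x)) absolutely_integrable_on {a..b}"
    using i3 g by (intro set_integral_add(1)) (auto simp: set_integrable_abs absolutely_integrable_norm comp_def intro: set_integrable_norm)
  define J where "J = integral {a..b} (\<lambda>x. \<bar>\<psi>' x\<bar> + norm (g x))"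
  have J0: "J \<ge> 0" unfolding J_def by (intro integral_nonneg) (use i4 in \<open>auto simp: absolutely_integrable_on_def\<close>)
  have sub: "f integrable_on {x..y}"
    if "f absolutely_integrable_on {a..b}" "a \<le> x" "y \<le> b" for f :: "real \<Rightarrow> 'c::euclidean_space" and x y
    using that absolutely_integrable_on_subinterval[of "{a..b}" f x y]
    by (auto simp: absolutely_integrable_on_def)
  define F where "F x y = \<psi> y *\<^sub>R u y - \<psi> x *\<^sub>R u x
      - (integral {x..y} (\<lambda>x. \<psi>' x *\<^sub>R u x) + integral {x..y} (\<lambda>x. \<psi> x *\<^sub>R g x))" for x y
  have comb: "integral {x..z} f = integral {x..y} f + integral {y..z} f"
    if "f absolutely_integrable_on {a..b}" "a \<le> x" "x \<le> y" "y \<le> z" "z \<le> b"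
    for f :: "real \<Rightarrow> 'c::euclidean_space" and x y z
    using that sub[of f x z] by (intro Henstock_Kurzweil_Integration.integral_combine[symmetric]) auto
  have "norm (F a b) \<le> \<epsilon>" if \<epsilon>: "\<epsilon> > 0" for \<epsilon>
  proof -
    define e where "e = \<epsilon> / (J + 1)"
    have e0: "e > 0" using \<epsilon> J0 by (simp add: e_def)
    have "norm (F a b) \<le> integral {a..b} (\<lambda>x. e * (\<bar>\<psi>' x\<bar> + norm (g x)))"
    proof (rule interval_function_le_of_local[OF ab])
      have i5: "(\<lambda>x. e * (\<bar>\<psi>' x\<bar> + norm (g x))) absolutely_integrable_on {a..b}"
        using i4 by simp
      show "integral {x..z} (\<lambda>x. e * (\<bar>\<psi>' x\<bar> + norm (g x))) =
        integral {x..y} (\<lambda>x. e * (\<bar>\<psi>' x\<bar> + norm (g x))) + integral {y..z} (\<lambda>x. e * (\<bar>\<psi>' x\<bar> + norm (g x)))"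
        if "a \<le> x" "x \<le> y" "y \<le> z" "z \<le> b" for x y z
        using comb[OF i5 that] .
      show "F x z = F x y + F y z" if "a \<le> x" "x \<le> y" "y \<le> z" "z \<le> b" for x y z
        unfolding F_def using comb[OF i1 that] comb[OF i2 that] by simp
      fix t assume t: "a \<le> t" "t \<le> b"
      obtain d1 where d1: "d1 > 0" "\<And>x. x \<in> {a..b} \<Longrightarrow> dist x t < d1 \<Longrightarrow> dist (u x) (u t) < e/2"
        using contu unfolding continuous_on_iff using t e0 by (metis atLeastAtMost_iff half_gt_zero)
      obtain d2 where d2: "d2 > 0" "\<And>x. x \<in> {a..b} \<Longrightarrow> dist x t < d2 \<Longrightarrow> dist (\<psi> x) (\<psi> t) < e/2"
        using cont\<psi> unfolding continuous_on_iff using t e0 by (metis atLeastAtMost_iff half_gt_zero)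
      show "\<exists>d>0. \<forall>x y. a \<le> x \<longrightarrow> x \<le> t \<longrightarrow> t \<le> y \<longrightarrow> y \<le> b \<longrightarrow> y - x < d \<longrightarrow>
              norm (F x y) \<le> integral {x..y} (\<lambda>x. e * (\<bar>\<psi>' x\<bar> + norm (g x)))"
      proof (intro exI[of _ "min d1 d2"] conjI allI impI)
        show "min d1 d2 > 0" using d1 d2 by simp
        fix x y assume xy: "a \<le> x" "x \<le> t" "t \<le> y" "y \<le> b" "y - x < min d1 d2"
        have near: "dist (u r) (u t) < e/2 \<and> dist (\<psi> r) (\<psi> t) < e/2" if "r \<in> {x..y}" for r
          using d1(2)[of r] d2(2)[of r] that xy by (auto simp: dist_real_def)
        have du: "norm (u y - u r) \<le> e" if "r \<in> {x..y}" for r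
        proof -
          have "dist (u y) (u t) < e/2" "dist (u r) (u t) < e/2"
            using near[of y] near[OF that] xy by auto
          then have "dist (u y) (u r) < e" by (rule dist_triangle_half_l)
          then show ?thesis by (simp add: dist_norm)
        qed
        have dp: "\<bar>\<psi> x - \<psi> r\<bar> \<le> e" if "r \<in> {x..y}" for r
        proof -
          have "dist (\<psi> x) (\<psi> t) < e/2" "dist (\<psi> r) (\<psi> t) < e/2"
            using near[of x] near[OF that] xy by auto
          then have "dist (\<psi> x) (\<psi> r) < e" by (rule dist_triangle_half_l)
          then show ?thesis by (simp add: dist_norm)
        qed
        have psi: "(\<psi>' has_integral (\<psi> y - \<psi> x)) {x..y}"
          using xy \<psi> by (intro fundamental_theorem_of_calculus)
            (auto simp: has_real_derivative_iff_has_vector_derivative[symmetric] intro: DERIV_subset)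
        have A: "((\<lambda>r. \<psi>' r *\<^sub>R u y) has_integral (\<psi> y - \<psi> x) *\<^sub>R u y) {x..y}"
          using has_integral_linear[OF psi bounded_linear_scaleR_left[of "u y"]] by (simp add: comp_def)
        have ig: "(g has_integral (u y - u x)) {x..y}"
          using sub[OF g, of x y] xy u[of x y] by (simp add: has_integral_iff)
        have B: "((\<lambda>r. \<psi> x *\<^sub>R g r) has_integral \<psi> x *\<^sub>R (u y - u x)) {x..y}"
          by (rule has_integral_cmul[OF ig])
        have C: "((\<lambda>r. (\<psi>' r *\<^sub>R u y + \<psi> x *\<^sub>R g r) - (\<psi>' r *\<^sub>R u r + \<psi> r *\<^sub>R g r)) has_integral F x y) {x..y}"
        proof -
          have "((\<lambda>r. (\<psi>' r *\<^sub>R u y + \<psi> x *\<^sub>R g r) - (\<psi>' r *\<^sub>R u r + \<psi> r *\<^sub>R g r)) has_integral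
             ((\<psi> y - \<psi> x) *\<^sub>R u y + \<psi> x *\<^sub>R (u y - u x))
              - (integral {x..y} (\<lambda>x. \<psi>' x *\<^sub>R u x) + integral {x..y} (\<lambda>x. \<psi> x *\<^sub>R g x))) {x..y}"
            by (intro has_integral_diff has_integral_add A B integrable_integral sub i1 i2) (use xy in auto)
          then show ?thesis unfolding F_def by (simp add: algebra_simps)
        qed
        show "norm (F x y) \<le> integral {x..y} (\<lambda>x. e * (\<bar>\<psi>' x\<bar> + norm (g x)))"
          unfolding integral_unique[OF C, symmetric]
        proof (rule integral_norm_bound_integral)
          show "(\<lambda>x. e * (\<bar>\<psi>' x\<bar> + norm (g x))) integrable_on {x..y}"
            using sub[OF i5] xy by auto
          fix r assume r: "r \<in> {x..y}"
          have "norm ((\<psi>' r *\<^sub>R u y + \<psi> x *\<^sub>R g r) - (\<psi>' r *\<^sub>R u r + \<psi> r *\<^sub>R g r))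
            = norm (\<psi>' r *\<^sub>R (u y - u r) + (\<psi> x - \<psi> r) *\<^sub>R g r)"
            by (simp add: algebra_simps)
          also have "\<dots> \<le> norm (\<psi>' r *\<^sub>R (u y - u r)) + norm ((\<psi> x - \<psi> r) *\<^sub>R g r)"
            by (rule norm_triangle_ineq)
          also have "\<dots> = \<bar>\<psi>' r\<bar> * norm (u y - u r) + \<bar>\<psi> x - \<psi> r\<bar> * norm (g r)"
            by simp
          also have "\<dots> \<le> \<bar>\<psi>' r\<bar> * e + e * norm (g r)"
            by (intro add_mono mult_left_mono mult_right_mono du dp r) auto
          finally show "norm ((\<psi>' r *\<^sub>R u y + \<psi> x *\<^sub>R g r) - (\<psi>' r *\<^sub>R u r + \<psi> r *\<^sub>R g r)) \<le> e * (\<bar>\<psi>' r\<bar> + norm (g r))"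
            by (simp add: algebra_simps)
        qed (use C in auto)
      qed
    qed
    also have "\<dots> = e * J" by (simp add: J_def)
    also have "\<dots> \<le> \<epsilon>" using \<epsilon> J0 by (simp add: e_def field_simps)
    finally show ?thesis .
  qed
  then have "norm (F a b) \<le> 0" using field_le_epsilon[of "norm (F a b)" 0] by simp
  then show ?thesis unfolding F_def by simp
qed

section \<open>Smooth test functions\<close>

definition smooth :: "(real \<Rightarrow> real) \<Rightarrow> bool" where
  "smooth f \<longleftrightarrow> (\<forall>k x. ((deriv ^^ k) f) differentiable (at x))"

text \<open>
  Smoothness is the largest property that passes to the derivative, which gives closure properties without
  formulas for higher derivatives.
\<close>

lemma smooth_coinduct:
  assumes "f \<in> S"
    and step: "\<And>g. g \<in> S \<Longrightarrow> (\<forall>x. g differentiable (at x)) \<and> deriv g \<in> S"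
  shows "smooth f"
proof -
  have "(deriv ^^ k) f \<in> S" for k
    by (induction k) (use assms in auto)
  then show ?thesis unfolding smooth_def using step by blast
qed

lemma smooth_differentiable: "smooth f \<Longrightarrow> f differentiable (at x)"
  unfolding smooth_def by (metis funpow_0)

lemma smooth_DERIV: "smooth f \<Longrightarrow> (f has_real_derivative deriv f x) (at x)"
  using smooth_differentiable[of f x] DERIV_deriv_iff_real_differentiable by blast

lemma smooth_deriv: "smooth f \<Longrightarrow> smooth (deriv f)"
  unfolding smooth_def by (metis funpow_Suc_right comp_apply)

lemma smooth_continuous_on: "smooth f \<Longrightarrow> continuous_on A f"
  by (meson smooth_DERIV DERIV_continuous continuous_at_imp_continuous_on)

lemma smooth_if_deriv:
  assumes "\<And>x. (f has_real_derivative f' x) (at x)" "smooth f'"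
  shows "smooth f"
proof (rule smooth_coinduct[where S = "insert f (Collect smooth)"])
  have "deriv f = f'" using assms(1) by (auto intro: DERIV_imp_deriv)
  then show "(\<forall>x. g differentiable (at x)) \<and> deriv g \<in> insert f (Collect smooth)"
    if "g \<in> insert f (Collect smooth)" for g
    using that assms smooth_deriv smooth_differentiable
    by (auto simp: real_differentiable_def)
qed auto

text \<open>
  The ring generated by the smooth functions is stable under differentiation by the Leibniz rule, so it consists of
  smooth functions.
\<close>

inductive_set smooth_ring :: "(real \<Rightarrow> real) set" where
  base: "smooth f \<Longrightarrow> f \<in> smooth_ring"
| add: "\<lbrakk>f \<in> smooth_ring; g \<in> smooth_ring\<rbrakk> \<Longrightarrow> (\<lambda>x. f x + g x) \<in> smooth_ring"
| mult: "\<lbrakk>f \<in> smooth_ring; g \<in> smooth_ring\<rbrakk> \<Longrightarrow> (\<lambda>x. f x * g x) \<in> smooth_ring"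

lemma smooth_ring_deriv:
  assumes "f \<in> smooth_ring"
  shows "\<exists>f'\<in>smooth_ring. \<forall>x. (f has_real_derivative f' x) (at x)"
  using assms
proof induction
  case (base f)
  then show ?case using smooth_deriv smooth_DERIV smooth_ring.base by blast
next
  case (add f g)
  then obtain f' g' where "f' \<in> smooth_ring" "g' \<in> smooth_ring"
    and d: "\<And>x. (f has_real_derivative f' x) (at x)" "\<And>x. (g has_real_derivative g' x) (at x)" by blast
  then show ?case
    by (intro bexI[of _ "\<lambda>x. f' x + g' x"] allI DERIV_add smooth_ring.add)
next
  case (mult f g)
  then obtain f' g' where m: "f' \<in> smooth_ring" "g' \<in> smooth_ring"
    and d: "\<And>x. (f has_real_derivative f' x) (at x)" "\<And>x. (g has_real_derivative g' x) (at x)" by blast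
  have "(\<lambda>x. f' x * g x + g' x * f x) \<in> smooth_ring"
    using m mult by (intro smooth_ring.add smooth_ring.mult)
  then show ?case by (rule bexI[rotated]) (use DERIV_mult[OF d] in simp)
qed

lemma smooth_ring_smooth: "f \<in> smooth_ring \<Longrightarrow> smooth f"
proof (erule smooth_coinduct)
  fix g assume "g \<in> smooth_ring"
  then obtain g' where g': "g' \<in> smooth_ring" "\<And>x. (g has_real_derivative g' x) (at x)"
    using smooth_ring_deriv by blast
  then have "deriv g = g'" by (auto intro: DERIV_imp_deriv)
  then show "(\<forall>x. g differentiable (at x)) \<and> deriv g \<in> smooth_ring"
    using g' by (auto simp: real_differentiable_def)
qed

lemma smooth_const: "smooth (\<lambda>x. c)"
  by (rule smooth_coinduct[where S = "range (\<lambda>c x. c)"]) auto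

lemma smooth_add: "\<lbrakk>smooth f; smooth g\<rbrakk> \<Longrightarrow> smooth (\<lambda>x. f x + g x)"
  and smooth_mult: "\<lbrakk>smooth f; smooth g\<rbrakk> \<Longrightarrow> smooth (\<lambda>x. f x * g x)"
  by (auto intro: smooth_ring_smooth smooth_ring.intros)

lemma smooth_diff: "\<lbrakk>smooth f; smooth g\<rbrakk> \<Longrightarrow> smooth (\<lambda>x. f x - g x)"
  using smooth_add[of f "\<lambda>x. (-1) * g x"] smooth_mult[OF smooth_const[of "-1"], of g] by simp

lemma smooth_affine:
  assumes "smooth f" shows "smooth (\<lambda>x. f (m * x + c))"
proof (rule smooth_coinduct[where S = "{\<lambda>x. k * g (m * x + c) |g k. smooth g}"])
  show "(\<lambda>x. f (m * x + c)) \<in> {\<lambda>x. k * g (m * x + c) |g k. smooth g}"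
    using assms by (auto intro!: exI[of _ f] exI[of _ 1])
  fix h assume "h \<in> {\<lambda>x. k * g (m * x + c) |g k. smooth g}"
  then obtain g k where g: "smooth g" "h = (\<lambda>x. k * g (m * x + c))" by auto
  have D: "(h has_real_derivative k * m * deriv g (m * x + c)) (at x)" for x
    unfolding g(2) by (rule derivative_eq_intros DERIV_chain2[OF smooth_DERIV[OF g(1)]] refl | simp)+
  then have "deriv h = (\<lambda>x. (k * m) * deriv g (m * x + c))"
    by (auto intro: DERIV_imp_deriv)
  then show "(\<forall>x. h differentiable (at x)) \<and> deriv h \<in> {\<lambda>x. k * g (m * x + c) |g k. smooth g}"
    using D smooth_deriv[OF g(1)] by (auto simp: real_differentiable_def)
qed

text \<open>
  For \<open>P = 1\<close> this is the standard function that is flat at the origin. A polynomial factor in \<open>1 / x\<close> makes the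
  family stable under differentiation.
\<close>

definition flat :: "real poly \<Rightarrow> real \<Rightarrow> real" where
  "flat P x = (if x \<le> 0 then 0 else poly P (1 / x) * exp (- (1 / x)))"

lemma flat_tendsto_0:
  "((\<lambda>t. poly P t * exp (- t)) \<longlongrightarrow> (0::real)) at_top"
proof -
  have "((\<lambda>t. \<Sum>i\<le>degree P. coeff P i * (t ^ i / exp t)) \<longlongrightarrow> (\<Sum>i\<le>degree P. coeff P i * 0)) at_top"
    by (intro tendsto_intros tendsto_power_div_exp_0)
  moreover have "(\<lambda>t. \<Sum>i\<le>degree P. coeff P i * (t ^ i / exp t)) = (\<lambda>t. poly P t * exp (- t))"
    by (auto simp: poly_altdef sum_distrib_right sum_divide_distrib exp_minus field_simps)
  ultimately show ?thesis by simp
qed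

lemma flat_DERIV:
  "(flat P has_real_derivative flat (monom 1 2 * (P - pderiv P)) x) (at x)"
proof (cases x "0::real" rule: linorder_cases)
  case less
  have "(flat P has_real_derivative 0) (at x)"
  proof (rule has_field_derivative_transform_within_open[where f = "\<lambda>_. 0" and S = "{..<0}"])
  qed (use less in \<open>auto simp: flat_def\<close>)
  then show ?thesis using less by (simp add: flat_def)
next
  case greater
  have "((\<lambda>x. poly P (1 / x) * exp (- (1 / x))) has_real_derivative
          (poly (pderiv P) (1/x) * (- (1 / x^2))) * exp (- (1/x)) + poly P (1/x) * (exp (-(1/x)) * (1 / x^2))) (at x)"
    by (rule derivative_eq_intros DERIV_chain2[OF poly_DERIV] refl | use greater in \<open>simp add: power2_eq_square\<close>)+
  also have "(poly (pderiv P) (1/x) * (- (1 / x^2))) * exp (- (1/x)) + poly P (1/x) * (exp (-(1/x)) * (1 / x^2))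
     = flat (monom 1 2 * (P - pderiv P)) x"
    using greater by (simp add: flat_def poly_monom field_simps)
  finally show ?thesis
    by (rule has_field_derivative_transform_within_open[where S = "{0<..}"]) (use greater in \<open>auto simp: flat_def\<close>)
next
  case equal
  have "((\<lambda>h. flat P h / h) \<longlongrightarrow> 0) (at_left 0)"
    by (rule tendsto_eventually) (auto simp: eventually_at_left_field flat_def intro!: exI[of _ "-1"])
  moreover have "((\<lambda>h. flat P h / h) \<longlongrightarrow> 0) (at_right 0)"
  proof -
    have "((\<lambda>h. poly (pCons 0 P) (inverse h) * exp (- inverse h)) \<longlongrightarrow> 0) (at_right 0)"
      by (rule filterlim_compose[OF flat_tendsto_0 filterlim_inverse_at_top_right])
    then show ?thesis
      by (rule Lim_transform_eventually)
        (auto simp: eventually_at_right_field flat_def field_simps intro!: exI[of _ "1"])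
  qed
  ultimately have "((\<lambda>h. flat P h / h) \<longlongrightarrow> 0) (at 0)"
    by (simp add: filterlim_split_at_real)
  then show ?thesis
    using equal by (simp add: DERIV_def flat_def)
qed

lemma smooth_flat: "smooth (flat P)"
proof (rule smooth_coinduct[where S = "range flat"])
  fix g assume "g \<in> range flat"
  then obtain Q where Q: "g = flat Q" by auto
  have "deriv g = flat (monom 1 2 * (Q - pderiv Q))"
    unfolding Q by (rule ext) (rule DERIV_imp_deriv[OF flat_DERIV])
  then show "(\<forall>x. g differentiable (at x)) \<and> deriv g \<in> range flat"
    using flat_DERIV[of Q] Q by (auto simp: real_differentiable_def)
qed auto

lemma real_antiderivative:
  fixes f :: "real \<Rightarrow> real"
  assumes "continuous_on UNIV f"
  obtains F where "\<And>x. (F has_real_derivative f x) (at x)" "F c = 0"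
proof -
  have "\<exists>F. \<forall>x::real. -\<infinity> < ereal x \<longrightarrow> ereal x < \<infinity> \<longrightarrow> (F has_vector_derivative f x) (at x)"
    by (rule einterval_antiderivative) (use assms in \<open>auto simp: continuous_on_eq_continuous_at\<close>)
  then obtain F where F: "\<And>x. (F has_real_derivative f x) (at x)"
    by (auto simp: has_real_derivative_iff_has_vector_derivative)
  have "((\<lambda>x. F x - F c) has_real_derivative f x) (at x)" for x
    using F[of x] by (auto intro!: derivative_eq_intros)
  then show ?thesis using that[of "\<lambda>x. F x - F c"] by simp
qed

text \<open>
  The step is the normalised primitive of the bump \<open>exp (-1 / x) exp (-1 / (1 - x))\<close> on \<open>(0, 1)\<close>.
\<close>

lemma smooth_step_exists:
  obtains s where "smooth s" "\<And>x. x \<le> 0 \<Longrightarrow> s x = 0" "\<And>x. x \<ge> 1 \<Longrightarrow> s x = 1"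
    "\<And>x. 0 \<le> s x" "\<And>x. s x \<le> 1"
proof -
  define b where "b x = flat 1 x * flat 1 (1 - x)" for x
  have sb: "smooth b"
    using smooth_mult[OF smooth_flat[of 1] smooth_affine[OF smooth_flat[of 1], of "-1" 1]]
    by (simp add: b_def[abs_def])
  have b0: "b x \<ge> 0" for x by (simp add: b_def flat_def)
  have b_out: "b x = 0" if "x \<le> 0 \<or> x \<ge> 1" for x using that by (auto simp: b_def flat_def)
  obtain B where B: "\<And>x. (B has_real_derivative b x) (at x)" "B 0 = 0"
    using real_antiderivative[OF smooth_continuous_on[OF sb]] by blast
  have mono: "B x \<le> B y" if "x \<le> y" for x y
    by (rule DERIV_nonneg_imp_nondecreasing[OF that]) (use B b0 in blast)
  have mvt: "\<exists>z. x < z \<and> z < y \<and> B y - B x = (y - x) * b z" if "x < y" for x y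
    using that B by (intro MVT2) auto
  have left: "B x = 0" if "x \<le> 0" for x
    using mvt[of x 0] that B(2) b_out by (cases "x = 0") force+
  have right: "B x = B 1" if "x \<ge> 1" for x
    using mvt[of 1 x] that b_out by (cases "x = 1") force+
  have "B 0 < B 1"
  proof -
    obtain z where z: "0 < z" "z < 1" "B 1 - B 0 = b z" using mvt[of 0 1] by auto
    have "b z > 0" using z by (simp add: b_def flat_def)
    then show ?thesis using z by simp
  qed
  then have B1: "B 1 > 0" using B by simp
  define s where "s x = (1 / B 1) * B x" for x
  have "smooth B" by (rule smooth_if_deriv[OF B(1) sb])
  then have "smooth s" unfolding s_def[abs_def] by (intro smooth_mult smooth_const)
  moreover have "s x = 0" if "x \<le> 0" for x using left[OF that] by (simp add: s_def)
  moreover have "s x = 1" if "x \<ge> 1" for x using right[OF that] B1 by (simp add: s_def)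
  moreover have "0 \<le> s x" for x
    using mono[of 0 x] left[of x] B B1 by (cases "0 \<le> x") (auto simp: s_def)
  moreover have "s x \<le> 1" for x
    using mono[of x 1] right[of x] B B1 by (cases "x \<le> 1") (auto simp: s_def)
  ultimately show ?thesis using that by blast
qed

lemma test_function_iff:
  "test_function \<psi> \<longleftrightarrow> smooth \<psi> \<and> (\<exists>a b. 0 < a \<and> a \<le> b \<and> (\<forall>x. x \<notin> {a..b} \<longrightarrow> \<psi> x = 0))"
proof
  assume t: "test_function \<psi>"
  define K where "K = closure {x. \<psi> x \<noteq> 0}"
  have K: "compact K" "K \<subseteq> {0<..}" using t by (auto simp: test_function_def K_def)
  have out: "\<psi> x = 0" if "x \<notin> K" for x using that subsetD[OF closure_subset, of x "{x. \<psi> x \<noteq> 0}"] by (auto simp: K_def)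
  show "smooth \<psi> \<and> (\<exists>a b. 0 < a \<and> a \<le> b \<and> (\<forall>x. x \<notin> {a..b} \<longrightarrow> \<psi> x = 0))"
  proof
    show "smooth \<psi>" using t by (auto simp: test_function_def smooth_def)
    show "\<exists>a b. 0 < a \<and> a \<le> b \<and> (\<forall>x. x \<notin> {a..b} \<longrightarrow> \<psi> x = 0)"
    proof (cases "K = {}")
      case True
      then show ?thesis using out by (intro exI[of _ 1]) auto
    next
      case False
      obtain a where a: "a \<in> K" "\<And>x. x \<in> K \<Longrightarrow> a \<le> x"
        using compact_attains_inf[OF K(1) False] by auto
      obtain b where b: "b \<in> K" "\<And>x. x \<in> K \<Longrightarrow> x \<le> b"
        using compact_attains_sup[OF K(1) False] by auto
      show ?thesis
      proof (rule exI[of _ a], rule exI[of _ b], intro conjI allI impI)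
        show "0 < a" "a \<le> b" using a b K by auto
        show "\<psi> x = 0" if "x \<notin> {a..b}" for x using that a b out by auto
      qed
    qed
  qed
next
  assume "smooth \<psi> \<and> (\<exists>a b. 0 < a \<and> a \<le> b \<and> (\<forall>x. x \<notin> {a..b} \<longrightarrow> \<psi> x = 0))"
  then obtain a b where s: "smooth \<psi>" and ab: "0 < a" "a \<le> b" "\<And>x. x \<notin> {a..b} \<Longrightarrow> \<psi> x = 0" by blast
  have sub: "closure {x. \<psi> x \<noteq> 0} \<subseteq> {a..b}"
  proof (rule closure_minimal)
    show "{x. \<psi> x \<noteq> 0} \<subseteq> {a..b}" using ab(3) by blast
  qed auto
  then have "compact (closure {x. \<psi> x \<noteq> 0})"
    using bounded_subset[OF bounded_closed_interval[of a b]] closure_subset[of "{x. \<psi> x \<noteq> 0}"] by auto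
  then show "test_function \<psi>"
    using s sub ab unfolding test_function_def smooth_def by auto
qed

text \<open>
  Differences of ever steeper smooth steps at \<open>a\<close> and at \<open>b\<close>. Both steps rise to the right of the jump, which
  is why the limit is the indicator of a half-open interval and the supports reach beyond \<open>b\<close>.
\<close>

lemma test_function_interval_approx:
  assumes "0 < a" "a < b"
  obtains \<xi> :: "nat \<Rightarrow> real \<Rightarrow> real" where
    "\<And>n. smooth (\<xi> n)" "\<And>n x. x \<notin> {a..b+1} \<Longrightarrow> \<xi> n x = 0" "\<And>n x. \<bar>\<xi> n x\<bar> \<le> 1"
    "\<And>x. (\<lambda>n. \<xi> n x) \<longlonglongrightarrow> indicator {a<..b} x"
proof -
  obtain s :: "real \<Rightarrow> real" where s: "smooth s" "\<And>x. x \<le> 0 \<Longrightarrow> s x = 0" "\<And>x. x \<ge> 1 \<Longrightarrow> s x = 1"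
    "\<And>x. 0 \<le> s x" "\<And>x. s x \<le> 1" using smooth_step_exists by blast
  define \<xi> where "\<xi> n x = s (real (Suc n) * x + (- real (Suc n) * a)) - s (real (Suc n) * x + (- real (Suc n) * b))" for n x
  have arg: "real (Suc n) * x + (- real (Suc n) * c) = real (Suc n) * (x - c)" for n x c
    by (simp add: algebra_simps)
  have sl: "(\<lambda>n. s (real (Suc n) * (x - c))) \<longlonglongrightarrow> (if x > c then 1 else 0)" for x c
  proof (cases "x > c")
    case True
    have "eventually (\<lambda>n. real (Suc n) * (x - c) \<ge> 1) sequentially"
    proof -
      obtain k :: nat where k: "real k * (x - c) > 1" using ex_less_of_nat_mult[of "x - c" 1] True by auto
      have "real (Suc n) * (x - c) \<ge> 1" if "n \<ge> k" for n
        using k that True mult_right_mono[of "real k" "real (Suc n)" "x - c"] by linarith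
      then show ?thesis by (auto simp: eventually_sequentially)
    qed
    then show ?thesis using True s(3) by (intro tendsto_eventually) (auto elim!: eventually_mono)
  next
    case False
    then have "s (real (Suc n) * (x - c)) = 0" for n by (intro s(2)) (simp add: mult_le_0_iff)
    then show ?thesis using False by simp
  qed
  show ?thesis
  proof (rule that[of \<xi>])
    show "smooth (\<xi> n)" for n unfolding \<xi>_def[abs_def] by (intro smooth_diff smooth_affine s(1))
    show "\<bar>\<xi> n x\<bar> \<le> 1" for n x
      using s(4,5)[of "real (Suc n) * x + (- real (Suc n) * a)"] s(4,5)[of "real (Suc n) * x + (- real (Suc n) * b)"]
      unfolding \<xi>_def by linarith
    show "\<xi> n x = 0" if "x \<notin> {a..b+1}" for n x
    proof (cases "x < a")
      case True
      then show ?thesis using assms unfolding \<xi>_def arg by (subst (1 2) s(2)) (auto simp: mult_le_0_iff)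
    next
      case False
      then have x: "x - b \<ge> 1" "x - a \<ge> 1" using that assms by auto
      then have "real (Suc n) * (x - b) \<ge> 1" "real (Suc n) * (x - a) \<ge> 1"
        using mult_mono[of 1 "real (Suc n)" 1 "x - b"] mult_mono[of 1 "real (Suc n)" 1 "x - a"] by auto
      then show ?thesis unfolding \<xi>_def arg by (simp only: s(3))
    qed
    show "(\<lambda>n. \<xi> n x) \<longlonglongrightarrow> indicator {a<..b} x" for x
    proof -
      have "(\<lambda>n. \<xi> n x) \<longlonglongrightarrow> (if x > a then 1 else 0) - (if x > b then 1 else 0)"
        unfolding \<xi>_def arg by (intro tendsto_diff sl)
      also have "(if x > a then 1 else 0) - (if x > b then 1 else 0) = (indicator {a<..b} x :: real)"
        using assms by (auto simp: indicator_def)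
      finally show ?thesis .
    qed
  qed
qed

section \<open>Sobolev functions on the half-line\<close>

lemma integrable_half_line_iff:
  fixes f :: "real \<Rightarrow> 'a::euclidean_space"
  shows "integrable half_line f \<longleftrightarrow> f absolutely_integrable_on {0<..}"
  unfolding set_integrable_def by (rule integrable_restrict_space) auto

lemma AE_half_lineI:
  assumes "negligible N" "\<And>x. x > 0 \<Longrightarrow> x \<notin> N \<Longrightarrow> P x"
  shows "AE x in half_line. P x"
proof -
  have "AE x in lebesgue. x \<notin> N"
    using assms(1) by (intro AE_not_in) (simp add: negligible_iff_null_sets)
  then have "AE x in lebesgue. x \<in> {0<..} \<longrightarrow> P x"
    by eventually_elim (use assms(2) in auto)
  then show ?thesis by (simp add: AE_restrict_space_iff)
qed

lemma AE_half_lineE: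
  assumes "AE x in half_line. P x"
  obtains N where "negligible N" "\<And>x. x > 0 \<Longrightarrow> x \<notin> N \<Longrightarrow> P x"
proof -
  have "AE x in lebesgue. x \<in> {0<..} \<longrightarrow> P x"
    using assms by (simp add: AE_restrict_space_iff)
  then obtain N where "{x \<in> space lebesgue. \<not> (x \<in> {0<..} \<longrightarrow> P x)} \<subseteq> N" "N \<in> null_sets lebesgue"
    unfolding eventually_ae_filter by blast
  then show ?thesis using that[of N] by (auto simp: negligible_iff_null_sets)
qed

text \<open>
  Intervals with left end \<open>a > 0\<close> suffice for pairing with test functions, whose supports stay away from \<open>0\<close>.
\<close>

definition locally_integrable :: "(real \<Rightarrow> complex) \<Rightarrow> bool" where
  "locally_integrable f \<longleftrightarrow> (\<forall>a b. 0 < a \<longrightarrow> f absolutely_integrable_on {a..b})"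

lemma locally_integrable_diff:
  "\<lbrakk>locally_integrable f; locally_integrable g\<rbrakk> \<Longrightarrow> locally_integrable (\<lambda>x. f x - g x)"
  unfolding locally_integrable_def by (simp add: set_integral_diff(1))

lemma continuous_locally_integrable:
  assumes "continuous_on {0..} u" shows "locally_integrable u"
  unfolding locally_integrable_def
  by (intro allI impI absolutely_integrable_continuous_real) (rule continuous_on_subset[OF assms], auto)

lemma L2_half_absolutely_integrable:
  assumes "f \<in> L2_half" "0 \<le> a"
  shows "f absolutely_integrable_on {a..b}"
proof -
  have m: "f \<in> borel_measurable (lebesgue_on {0<..b})"
    by (rule measurable_restrict_mono[where A = "{0<..}"]) (use assms(1) in \<open>auto simp: L2_half_def\<close>)
  have "(\<lambda>x. (cmod (f x))\<^sup>2) absolutely_integrable_on {0<..}"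
    using assms(1) by (simp add: L2_half_def integrable_half_line_iff)
  then have "(\<lambda>x. (cmod (f x))\<^sup>2) absolutely_integrable_on {0<..b}"
    by (rule set_integrable_subset) auto
  moreover have "(\<lambda>x. 1::real) absolutely_integrable_on {0<..b}"
    by (rule absolutely_integrable_on_const) (simp add: bounded_set_imp_lmeasurable)
  ultimately have i: "(\<lambda>x. 1 + (cmod (f x))\<^sup>2) absolutely_integrable_on {0<..b}"
    by (intro set_integral_add(1))
  have "f absolutely_integrable_on {0<..b}"
  proof (rule measurable_bounded_by_integrable_imp_absolutely_integrable[OF m])
    show "(\<lambda>x. 1 + (cmod (f x))\<^sup>2) integrable_on {0<..b}"
      using i by (simp add: absolutely_integrable_on_def)
    show "cmod (f x) \<le> 1 + (cmod (f x))\<^sup>2" for x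
      using zero_le_power2[of "2 * cmod (f x) - 1"] zero_le_power2[of "cmod (f x)"]
      by (simp add: power2_eq_square algebra_simps)
  qed auto
  then have "f absolutely_integrable_on {0..b}"
    by (rule absolutely_integrable_spike_set) (auto intro: negligible_subset[of "{0}"])
  then show ?thesis
    by (rule absolutely_integrable_on_subinterval) (use assms in auto)
qed

lemma L2_half_locally_integrable: "f \<in> L2_half \<Longrightarrow> locally_integrable f"
  using L2_half_absolutely_integrable by (simp add: locally_integrable_def)

lemma test_functionE:
  assumes "test_function \<psi>"
  obtains a b where "0 < a" "a \<le> b" "\<And>x. x \<notin> {a..b} \<Longrightarrow> \<psi> x = 0"
  using assms test_function_iff by blast

lemma test_function_smooth: "test_function \<psi> \<Longrightarrow> smooth \<psi>"
  by (simp add: test_function_iff)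

lemma deriv_zero_outside:
  fixes \<psi> :: "real \<Rightarrow> real"
  assumes "\<And>x. x \<notin> {a..b} \<Longrightarrow> \<psi> x = 0" "x \<notin> {a..b}"
  shows "deriv \<psi> x = 0"
proof -
  have "(\<psi> has_real_derivative 0) (at x)"
    by (rule has_field_derivative_transform_within_open[where f = "\<lambda>_. 0" and S = "- {a..b}"])
      (use assms in auto)
  then show ?thesis by (rule DERIV_imp_deriv)
qed

lemma test_function_deriv:
  assumes "test_function \<psi>" shows "test_function (deriv \<psi>)"
proof -
  obtain a b where "0 < a" "a \<le> b" "\<And>x. x \<notin> {a..b} \<Longrightarrow> \<psi> x = 0"
    using assms test_functionE by blast
  then show ?thesis
    using deriv_zero_outside[of a b \<psi>] smooth_deriv[OF test_function_smooth[OF assms]]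
    unfolding test_function_iff by blast
qed

lemma test_pairing:
  assumes s: "continuous_on UNIV \<psi>" and ab: "0 < a" "\<And>x. x \<notin> {a..b} \<Longrightarrow> \<psi> x = 0" and f: "locally_integrable f"
  shows "integrable half_line (\<lambda>x. \<psi> x *\<^sub>R f x)"
    and "(LINT x|half_line. \<psi> x *\<^sub>R f x) = integral {a..b} (\<lambda>x. \<psi> x *\<^sub>R f x)"
proof -
  have i: "(\<lambda>x. \<psi> x *\<^sub>R f x) absolutely_integrable_on {a..b}"
    using f ab continuous_on_subset[OF s] by (intro absolutely_integrable_continuous_mult) (auto simp: locally_integrable_def)
  have eq: "(\<lambda>x. indicat_real {0<..} x *\<^sub>R \<psi> x *\<^sub>R f x) = (\<lambda>x. indicat_real {a..b} x *\<^sub>R \<psi> x *\<^sub>R f x)"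
  proof
    fix x show "indicat_real {0<..} x *\<^sub>R \<psi> x *\<^sub>R f x = indicat_real {a..b} x *\<^sub>R \<psi> x *\<^sub>R f x"
      using ab by (cases "x \<in> {a..b}") auto
  qed
  show "integrable half_line (\<lambda>x. \<psi> x *\<^sub>R f x)"
    using i unfolding integrable_half_line_iff set_integrable_def eq .
  have "(LINT x|half_line. \<psi> x *\<^sub>R f x) = (LINT x|lebesgue. indicat_real {0<..} x *\<^sub>R \<psi> x *\<^sub>R f x)"
    by (simp add: integral_restrict_space)
  also have "\<dots> = (LINT x:{a..b}|lebesgue. \<psi> x *\<^sub>R f x)"
    unfolding eq set_lebesgue_integral_def ..
  also have "\<dots> = integral {a..b} (\<lambda>x. \<psi> x *\<^sub>R f x)"
    by (rule set_lebesgue_integral_eq_integral(2)[OF i])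
  finally show "(LINT x|half_line. \<psi> x *\<^sub>R f x) = integral {a..b} (\<lambda>x. \<psi> x *\<^sub>R f x)" .
qed

lemma test_pairing_integrable:
  assumes "test_function \<psi>" "locally_integrable f"
  shows "integrable half_line (\<lambda>x. \<psi> x *\<^sub>R f x)"
proof -
  obtain a b where "0 < a" "a \<le> b" "\<And>x. x \<notin> {a..b} \<Longrightarrow> \<psi> x = 0"
    using assms test_functionE by blast
  then show ?thesis
    using test_pairing(1)[OF smooth_continuous_on[OF test_function_smooth[OF assms(1)]] _ _ assms(2)] by blast
qed

text \<open>
  By the Lebesgue differentiation theorem \<open>h\<close> is almost everywhere the limit of its averages over shrinking
  intervals.
\<close>

lemma AE_zero_if_interval_integrals_zero:
  assumes h: "locally_integrable h" and z: "\<And>a b. \<lbrakk>0 < a; a < b\<rbrakk> \<Longrightarrow> integral {a..b} h = 0"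
  shows "AE x in half_line. h x = 0"
proof -
  have "\<exists>N. negligible N \<and> (\<forall>x. 0 < x \<longrightarrow> 1 / real (Suc n) < x \<longrightarrow> x \<notin> N \<longrightarrow> h x = 0)" for n
  proof -
    define c where "c = 1 / real (Suc n)"
    have c: "c > 0" by (simp add: c_def)
    \<comment> \<open>cutting off near \<open>0\<close> makes the function integrable on every compact interval\<close>
    define k where "k x = (if x \<in> {c..} then h x else 0)" for x
    have "k integrable_on cbox a b" for a b
    proof -
      have "h integrable_on {max a c..b}"
        using h c by (auto simp: locally_integrable_def absolutely_integrable_on_def)
      also have "{max a c..b} = {c..} \<inter> cbox a b" by auto
      finally show ?thesis by (simp only: k_def[abs_def] integrable_restrict_Int)
    qed
    then obtain N where N: "negligible N" and
      lim: "\<And>x e. \<lbrakk>x \<notin> N; 0 < e\<rbrakk> \<Longrightarrow> \<exists>d>0. \<forall>r. 0 < r \<and> r < d \<longrightarrow>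
                norm (integral (cbox x (x + r *\<^sub>R One)) k /\<^sub>R r ^ DIM(real) - k x) < e"
      using integrable_ccontinuous_explicit[of k] by blast
    have "h x = 0" if x: "c < x" "x \<notin> N" for x
    proof (rule ccontr)
      assume "h x \<noteq> 0"
      then have "norm (k x) > 0" using x by (simp add: k_def)
      then obtain d where d: "d > 0" "\<And>r. 0 < r \<Longrightarrow> r < d \<Longrightarrow>
          norm (integral (cbox x (x + r *\<^sub>R One)) k /\<^sub>R r ^ DIM(real) - k x) < norm (k x)"
        using lim[OF x(2)] by blast
      have "integral {x..x + d/2} k = integral {x..x + d/2} h"
        by (rule integral_cong) (use x in \<open>auto simp: k_def\<close>)
      also have "\<dots> = 0" using x c d by (intro z) auto
      finally show False using d(2)[of "d/2"] d(1) by simp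
    qed
    then show ?thesis using N c unfolding c_def by blast
  qed
  then obtain N where N: "\<And>n. negligible (N n)"
      "\<And>n x. 0 < x \<Longrightarrow> 1 / real (Suc n) < x \<Longrightarrow> x \<notin> N n \<Longrightarrow> h x = 0" by metis
  show ?thesis
  proof (rule AE_half_lineI)
    show "negligible (\<Union>n. N n)" using N(1) by (rule negligible_Union_nat)
    fix x :: real assume x: "x > 0" "x \<notin> (\<Union>n. N n)"
    obtain n where "1 / real (Suc n) < x"
      using x(1) by (metis inverse_eq_divide reals_Archimedean)
    then show "h x = 0" using N(2) x by blast
  qed
qed

text \<open>
  The fundamental lemma of the calculus of variations: let test functions tend boundedly to the indicator of
  an interval.
\<close>

lemma AE_zero_if_test_integrals_zero:
  assumes h: "locally_integrable h"
    and z: "\<And>\<psi>. test_function \<psi> \<Longrightarrow> (LINT x|half_line. \<psi> x *\<^sub>R h x) = 0"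
  shows "AE x in half_line. h x = 0"
proof (rule AE_zero_if_interval_integrals_zero[OF h])
  fix a b :: real assume ab: "0 < a" "a < b"
  obtain \<xi> :: "nat \<Rightarrow> real \<Rightarrow> real" where \<xi>: "\<And>n. smooth (\<xi> n)" "\<And>n x. x \<notin> {a..b+1} \<Longrightarrow> \<xi> n x = 0"
    "\<And>n x. \<bar>\<xi> n x\<bar> \<le> 1" "\<And>x. (\<lambda>n. \<xi> n x) \<longlonglongrightarrow> indicator {a<..b} x"
    using test_function_interval_approx[OF ab] by blast
  have test: "test_function (\<xi> n)" for n
    unfolding test_function_iff
  proof (intro conjI \<xi>(1), rule exI[of _ a], rule exI[of _ "b+1"])
  qed (use ab \<xi>(2) in auto)
  have h': "h absolutely_integrable_on {a..b+1}" using h ab by (simp add: locally_integrable_def)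
  have "(\<lambda>n. integral {a..b+1} (\<lambda>x. \<xi> n x *\<^sub>R h x)) \<longlonglongrightarrow> integral {a..b+1} (\<lambda>x. indicat_real {a<..b} x *\<^sub>R h x)"
  proof (rule dominated_convergence(2))
    show "(\<lambda>x. \<xi> k x *\<^sub>R h x) integrable_on {a..b + 1}" for k
      using absolutely_integrable_continuous_mult[OF smooth_continuous_on[OF \<xi>(1)] h']
      by (simp add: absolutely_integrable_on_def)
    show "(\<lambda>x. norm (h x)) integrable_on {a..b+1}" using h' by (simp add: absolutely_integrable_on_def)
    show "norm (\<xi> k x *\<^sub>R h x) \<le> norm (h x)" for k x
      using mult_right_mono[OF \<xi>(3)[of k x], of "norm (h x)"] by simp
    show "(\<lambda>k. \<xi> k x *\<^sub>R h x) \<longlonglongrightarrow> indicat_real {a<..b} x *\<^sub>R h x" for x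
      by (intro tendsto_intros \<xi>(4))
  qed
  moreover have "integral {a..b+1} (\<lambda>x. \<xi> n x *\<^sub>R h x) = 0" for n
    using test_pairing(2)[of "\<xi> n" a "b + 1" h] smooth_continuous_on[OF \<xi>(1)] ab(1) \<xi>(2) h z[OF test, of n] by simp
  ultimately have "(\<lambda>n. 0) \<longlonglongrightarrow> integral {a..b+1} (\<lambda>x. indicat_real {a<..b} x *\<^sub>R h x)"
    by simp
  then have "integral {a..b+1} (\<lambda>x. indicat_real {a<..b} x *\<^sub>R h x) = 0"
    by (simp add: LIMSEQ_const_iff)
  also have "integral {a..b+1} (\<lambda>x. indicat_real {a<..b} x *\<^sub>R h x) = integral {a..b+1} (\<lambda>x. if x \<in> {a<..b} then h x else 0)"
    by (rule integral_cong) auto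
  also have "\<dots> = integral ({a<..b} \<inter> {a..b+1}) h"
    by (rule integral_restrict_Int)
  also have "\<dots> = integral {a..b} h"
    by (rule integral_spike_set) (auto intro: negligible_subset[of "{a}"])
  finally show "integral {a..b} h = 0" .
qed

lemma primitive_has_weak_deriv:
  assumes g: "locally_integrable g" and u: "continuous_on {0..} u"
    and inc: "\<And>x y. \<lbrakk>0 < x; x \<le> y\<rbrakk> \<Longrightarrow> u y - u x = integral {x..y} g"
  shows "has_weak_deriv u g"
  unfolding has_weak_deriv_def
proof (intro allI impI)
  fix \<psi> assume t: "test_function \<psi>"
  note s = test_function_smooth[OF t]
  obtain a0 b0 where ab0: "0 < a0" "a0 \<le> b0" "\<And>x. x \<notin> {a0..b0} \<Longrightarrow> \<psi> x = 0"
    using t test_functionE by blast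
  \<comment> \<open>enlarge the interval so that \<open>\<psi>\<close> vanishes at its end points\<close>
  define a b where "a = a0 / 2" and "b = b0 + 1"
  have ab: "0 < a" "a \<le> b" "\<And>x. x \<notin> {a..b} \<Longrightarrow> \<psi> x = 0" "\<psi> a = 0" "\<psi> b = 0"
    using ab0 by (auto simp: a_def b_def)
  have "integral {a..b} (\<lambda>x. deriv \<psi> x *\<^sub>R u x) + integral {a..b} (\<lambda>x. \<psi> x *\<^sub>R g x) = \<psi> b *\<^sub>R u b - \<psi> a *\<^sub>R u a"
  proof (rule integral_by_parts_primitive)
    show "g absolutely_integrable_on {a..b}" using g ab by (simp add: locally_integrable_def)
    show "continuous_on {a..b} u" by (rule continuous_on_subset[OF u]) (use ab in auto)
    show "continuous_on {a..b} (deriv \<psi>)" by (intro smooth_continuous_on smooth_deriv s)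
  qed (use ab inc smooth_DERIV[OF s] in auto)
  then have "integral {a..b} (\<lambda>x. deriv \<psi> x *\<^sub>R u x) = - integral {a..b} (\<lambda>x. \<psi> x *\<^sub>R g x)"
    using ab by (simp add: eq_neg_iff_add_eq_0)
  moreover have "(LINT x|half_line. deriv \<psi> x *\<^sub>R u x) = integral {a..b} (\<lambda>x. deriv \<psi> x *\<^sub>R u x)"
    by (intro test_pairing(2) smooth_continuous_on smooth_deriv s ab(1) continuous_locally_integrable[OF u]
      deriv_zero_outside[OF ab(3)])
  moreover have "(LINT x|half_line. \<psi> x *\<^sub>R g x) = integral {a..b} (\<lambda>x. \<psi> x *\<^sub>R g x)"
    by (intro test_pairing(2) smooth_continuous_on s ab(1) g ab(3))
  ultimately show "(LINT x|half_line. deriv \<psi> x *\<^sub>R u x) = - (LINT x|half_line. \<psi> x *\<^sub>R g x)"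
    by simp
qed

text \<open>
  The du Bois-Reymond lemma. A test function \<open>\<xi>\<close> with integral \<open>T\<close> differs from \<open>T\<close> times a fixed
  bump \<open>\<sigma>'\<close> of integral one by the derivative of a test function. Hence \<open>h\<close> pairs with \<open>\<xi>\<close> to \<open>T c\<close>, where \<open>c\<close>
  is the pairing of \<open>h\<close> with \<open>\<sigma>'\<close>, and so does the constant \<open>c\<close>.
\<close>

lemma constant_if_weak_deriv_zero:
  assumes h: "locally_integrable h"
    and z: "\<And>\<psi>. test_function \<psi> \<Longrightarrow> (LINT x|half_line. deriv \<psi> x *\<^sub>R h x) = 0"
  obtains c where "AE x in half_line. h x = c"
proof -
  obtain s :: "real \<Rightarrow> real" where s: "smooth s" "\<And>x. x \<le> 0 \<Longrightarrow> s x = 0" "\<And>x. x \<ge> 1 \<Longrightarrow> s x = 1"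
    "\<And>x. 0 \<le> s x" "\<And>x. s x \<le> 1"
    using smooth_step_exists by blast
  define \<sigma> where "\<sigma> x = s (1 * x + (-1))" for x
  have \<sigma>: "smooth \<sigma>" "\<And>x. x \<le> 1 \<Longrightarrow> \<sigma> x = 0" "\<And>x. x \<ge> 2 \<Longrightarrow> \<sigma> x = 1"
    using smooth_affine[OF s(1), of 1 "-1"] s by (auto simp: \<sigma>_def[abs_def])
  have dout: "deriv \<sigma> x = 0" if "x \<notin> {1..2}" for x
  proof (cases "x < 1")
    case True
    have "(\<sigma> has_real_derivative 0) (at x)"
      by (rule has_field_derivative_transform_within_open[where f = "\<lambda>_. 0" and S = "{..<1}"]) (use \<sigma> True in auto)
    then show ?thesis by (rule DERIV_imp_deriv)
  next
    case False
    have "(\<sigma> has_real_derivative 0) (at x)"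
      by (rule has_field_derivative_transform_within_open[where f = "\<lambda>_. 1" and S = "{2<..}"]) (use \<sigma> False that in auto)
    then show ?thesis by (rule DERIV_imp_deriv)
  qed
  have td: "test_function (deriv \<sigma>)"
    unfolding test_function_iff
  proof (intro conjI smooth_deriv \<sigma>(1), rule exI[of _ 1], rule exI[of _ 2])
  qed (use dout in auto)
  define c where "c = (LINT x|half_line. deriv \<sigma> x *\<^sub>R h x)"
  have lic: "locally_integrable (\<lambda>x. c)"
    by (rule continuous_locally_integrable) auto
  have "AE x in half_line. h x - c = 0"
  proof (rule AE_zero_if_test_integrals_zero)
    show "locally_integrable (\<lambda>x. h x - c)" by (rule locally_integrable_diff[OF h lic])
    fix \<xi> assume t: "test_function \<xi>"
    note sx = test_function_smooth[OF t]
    obtain a b where ab: "0 < a" "a \<le> b" "\<And>x. x \<notin> {a..b} \<Longrightarrow> \<xi> x = 0"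
      using t test_functionE by blast
    obtain \<Xi> where X: "\<And>x. (\<Xi> has_real_derivative \<xi> x) (at x)" "\<Xi> a = 0"
      using real_antiderivative[OF smooth_continuous_on[OF sx]] by blast
    define T where "T = \<Xi> b"
    have mvt: "\<exists>z. x < z \<and> z < y \<and> \<Xi> y - \<Xi> x = (y - x) * \<xi> z" if "x < y" for x y
      using that X by (intro MVT2) auto
    have left: "\<Xi> x = 0" if "x \<le> a" for x
      using mvt[of x a] that X(2) ab(3) by (cases "x = a") force+
    have right: "\<Xi> x = T" if "x \<ge> b" for x
      using mvt[of b x] that ab(3) unfolding T_def by (cases "x = b") force+
    \<comment> \<open>both terms equal \<open>T\<close> far to the right, so \<open>\<psi>\<close> has compact support\<close>
    define \<psi> where "\<psi> x = \<Xi> x - T * \<sigma> x" for x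
    have D: "(\<psi> has_real_derivative \<xi> x - T * deriv \<sigma> x) (at x)" for x
      unfolding \<psi>_def[abs_def] by (intro derivative_intros X(1) DERIV_cmult smooth_DERIV \<sigma>(1))
    have "smooth \<psi>"
      unfolding \<psi>_def[abs_def] by (intro smooth_diff smooth_mult smooth_const \<sigma>(1) smooth_if_deriv[OF X(1) sx])
    moreover have "\<psi> x = 0" if "x \<notin> {min a 1..max b 2}" for x
      using left[of x] right[of x] \<sigma>(2,3)[of x] that by (auto simp: \<psi>_def)
    ultimately have tp: "test_function \<psi>"
      unfolding test_function_iff using ab
      by (intro conjI exI[of _ "min a 1"] exI[of _ "max b 2"]) (auto intro!: exI[of _ "max b 2"])
    have "deriv \<psi> = (\<lambda>x. \<xi> x - T * deriv \<sigma> x)" using D by (auto intro: DERIV_imp_deriv)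
    with z[OF tp] have "(LINT x|half_line. \<xi> x *\<^sub>R h x - T *\<^sub>R (deriv \<sigma> x *\<^sub>R h x)) = 0"
      by (simp add: scaleR_diff_left)
    moreover have "(LINT x|half_line. \<xi> x *\<^sub>R h x - T *\<^sub>R (deriv \<sigma> x *\<^sub>R h x)) =
        (LINT x|half_line. \<xi> x *\<^sub>R h x) - T *\<^sub>R c"
      unfolding c_def using test_pairing_integrable[OF t h] test_pairing_integrable[OF td h]
      by (subst Bochner_Integration.integral_diff) (auto simp del: scaleR_scaleR)
    ultimately have "(LINT x|half_line. \<xi> x *\<^sub>R h x) = T *\<^sub>R c" by simp
    moreover have "(LINT x|half_line. \<xi> x *\<^sub>R c) = T *\<^sub>R c"
    proof -
      have Xi: "(\<xi> has_integral \<Xi> b - \<Xi> a) {a..b}"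
        using ab X(1) by (intro fundamental_theorem_of_calculus)
          (auto simp: has_real_derivative_iff_has_vector_derivative[symmetric] intro: DERIV_subset)
      have "((\<lambda>x. \<xi> x *\<^sub>R c) has_integral T *\<^sub>R c) {a..b}"
        using has_integral_linear[OF Xi bounded_linear_scaleR_left[of c]] X(2) by (simp add: comp_def T_def)
      then show ?thesis
        using test_pairing(2)[OF smooth_continuous_on[OF sx] ab(1,3) lic] by (simp add: integral_unique)
    qed
    ultimately show "(LINT x|half_line. \<xi> x *\<^sub>R (h x - c)) = 0"
      using test_pairing_integrable[OF t h] test_pairing_integrable[OF t lic]
      by (simp add: scaleR_diff_right Bochner_Integration.integral_diff)
  qed
  then show ?thesis using that[of c] by simp
qed

text \<open>
  The primitive of \<open>g\<close> has the same weak derivative as \<open>f\<close>, so that the two differ by a constant.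
\<close>

lemma H1_representative:
  assumes f: "f \<in> L2_half" and g: "g \<in> L2_half" and w: "has_weak_deriv f g"
  obtains u where "continuous_on {0..} u" "AE x in half_line. f x = u x"
    "\<And>x y. \<lbrakk>0 \<le> x; x \<le> y\<rbrakk> \<Longrightarrow> u y - u x = integral {x..y} g"
proof -
  define u0 where "u0 x = integral {0..x} g" for x
  have ig: "g integrable_on {a..b}" if "0 \<le> a" for a b
    using L2_half_absolutely_integrable[OF g that] by (simp add: absolutely_integrable_on_def)
  have inc: "u0 y - u0 x = integral {x..y} g" if "0 \<le> x" "x \<le> y" for x y
    using Henstock_Kurzweil_Integration.integral_combine[of 0 x y g] ig that by (simp add: u0_def algebra_simps)
  have cont: "continuous_on {0..} u0"
    unfolding continuous_on_eq_continuous_within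
  proof
    fix x :: real assume x: "x \<in> {0..}"
    have "continuous_on {0..x+1} u0"
      unfolding u0_def using ig by (intro indefinite_integral_continuous_1) auto
    then have "continuous (at x within {0..x+1}) u0"
      using x by (simp add: continuous_on_eq_continuous_within)
    moreover have "at x within {0..x+1} = at x within {0..}"
      by (rule at_within_nhd[of x "{..<x+1}"]) auto
    ultimately show "continuous (at x within {0..}) u0" by simp
  qed
  note lf = L2_half_locally_integrable[OF f] and lg = L2_half_locally_integrable[OF g]
    and lu = continuous_locally_integrable[OF cont]
  have wu: "has_weak_deriv u0 g"
    by (rule primitive_has_weak_deriv[OF lg cont]) (use inc in auto)
  obtain c where c: "AE x in half_line. f x - u0 x = c"
  proof (rule constant_if_weak_deriv_zero[OF locally_integrable_diff[OF lf lu]])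
    fix \<psi> assume t: "test_function \<psi>"
    note td = test_function_deriv[OF t]
    show "(LINT x|half_line. deriv \<psi> x *\<^sub>R (f x - u0 x)) = 0"
      using w wu t test_pairing_integrable[OF td lf] test_pairing_integrable[OF td lu]
      by (simp add: has_weak_deriv_def scaleR_diff_right Bochner_Integration.integral_diff)
  qed
  show ?thesis
  proof (rule that[of "\<lambda>x. u0 x + c"])
    show "continuous_on {0..} (\<lambda>x. u0 x + c)" by (intro continuous_intros cont)
    show "AE x in half_line. f x = u0 x + c" using c by eventually_elim (simp add: algebra_simps)
  qed (use inc in auto)
qed

lemma weak_deriv_unique:
  assumes "has_weak_deriv f g" "has_weak_deriv f h" "g \<in> L2_half" "h \<in> L2_half"
  shows "AE x in half_line. g x = h x"
proof -
  note lg = L2_half_locally_integrable[OF assms(3)] and lh = L2_half_locally_integrable[OF assms(4)]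
  have "AE x in half_line. g x - h x = 0"
  proof (rule AE_zero_if_test_integrals_zero[OF locally_integrable_diff[OF lg lh]])
    fix \<psi> assume t: "test_function \<psi>"
    have "(LINT x|half_line. \<psi> x *\<^sub>R g x) = (LINT x|half_line. \<psi> x *\<^sub>R h x)"
      using assms(1)[unfolded has_weak_deriv_def, rule_format, OF t]
        assms(2)[unfolded has_weak_deriv_def, rule_format, OF t] by simp
    then show "(LINT x|half_line. \<psi> x *\<^sub>R (g x - h x)) = 0"
      using test_pairing_integrable[OF t lg] test_pairing_integrable[OF t lh]
      by (simp add: scaleR_diff_right Bochner_Integration.integral_diff)
  qed
  then show ?thesis by simp
qed

lemma weak_deriv_properties:
  assumes "f \<in> H1_half"
  shows "weak_deriv f \<in> L2_half" "has_weak_deriv f (weak_deriv f)"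
proof -
  have "\<exists>g. g \<in> L2_half \<and> has_weak_deriv f g" using assms by (auto simp: H1_half_def)
  then have "weak_deriv f \<in> L2_half \<and> has_weak_deriv f (weak_deriv f)"
    unfolding weak_deriv_def by (rule someI_ex)
  then show "weak_deriv f \<in> L2_half" "has_weak_deriv f (weak_deriv f)" by auto
qed

lemma has_weak_deriv_cong_AE:
  assumes "AE x in half_line. f x = f' x" "f \<in> L2_half" "f' \<in> L2_half" "has_weak_deriv f g"
  shows "has_weak_deriv f' g"
  unfolding has_weak_deriv_def
proof (intro allI impI)
  fix \<psi> assume t: "test_function \<psi>"
  note td = test_function_deriv[OF t]
  have "(LINT x|half_line. deriv \<psi> x *\<^sub>R f' x) = (LINT x|half_line. deriv \<psi> x *\<^sub>R f x)"
  proof (rule integral_cong_AE)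
    show "AE x in half_line. deriv \<psi> x *\<^sub>R f' x = deriv \<psi> x *\<^sub>R f x"
      using assms(1) by eventually_elim simp
    show "(\<lambda>x. deriv \<psi> x *\<^sub>R f' x) \<in> borel_measurable half_line"
      by (rule borel_measurable_integrable[OF test_pairing_integrable[OF td L2_half_locally_integrable[OF assms(3)]]])
    show "(\<lambda>x. deriv \<psi> x *\<^sub>R f x) \<in> borel_measurable half_line"
      by (rule borel_measurable_integrable[OF test_pairing_integrable[OF td L2_half_locally_integrable[OF assms(2)]]])
  qed
  then show "(LINT x|half_line. deriv \<psi> x *\<^sub>R f' x) = - (LINT x|half_line. \<psi> x *\<^sub>R g x)"
    using assms(4) t by (simp add: has_weak_deriv_def)
qed

text \<open>
  The set where \<open>u\<close> and \<open>v\<close> differ inside \<open>(0, \<infinity>)\<close> is open and negligible, hence empty; the value at \<open>0\<close>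
  follows by continuity.
\<close>

lemma AE_eq_continuous_imp_eq:
  fixes u v :: "real \<Rightarrow> complex"
  assumes u: "continuous_on {0..} u" and v: "continuous_on {0..} v" and "AE x in half_line. u x = v x" and "x \<ge> 0"
  shows "u x = v x"
proof -
  obtain N where N: "negligible N" "\<And>x. x > 0 \<Longrightarrow> x \<notin> N \<Longrightarrow> u x = v x"
    using assms(3) AE_half_lineE by blast
  define d where "d x = u x - v x" for x
  have cd: "continuous_on {0..} d" unfolding d_def by (intro continuous_intros u v)
  have "open ({0<..} \<inter> d -` (- {0}))"
    by (rule continuous_open_preimage[OF continuous_on_subset[OF cd]]) auto
  moreover have "negligible ({0<..} \<inter> d -` (- {0}))"
    using N by (intro negligible_subset[OF N(1)]) (auto simp: d_def)
  ultimately have "{0<..} \<inter> d -` (- {0}) = {}"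
    using open_not_negligible by blast
  then have z: "d x = 0" if "x > 0" for x using that by auto
  have "d x = 0" if "x \<in> closure {0<..}" for x
    by (rule continuous_constant_on_closure[OF _ _ that]) (use cd z in auto)
  then show ?thesis using assms(4) by (simp add: d_def)
qed

lemma trace0_eqI:
  assumes "continuous_on {0..} u" "AE x in half_line. f x = u x"
  shows "trace0 f = u 0"
  unfolding trace0_def
proof (rule the_equality)
  show "\<exists>v. continuous_on {0..} v \<and> (AE x in half_line. f x = v x) \<and> v 0 = u 0"
    using assms by blast
  fix c assume "\<exists>v. continuous_on {0..} v \<and> (AE x in half_line. f x = v x) \<and> v 0 = c"
  then obtain v where v: "continuous_on {0..} v" "AE x in half_line. f x = v x" "v 0 = c" by blast
  have "AE x in half_line. v x = u x" using v(2) assms(2) by eventually_elim simp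
  from AE_eq_continuous_imp_eq[OF v(1) assms(1) this, of 0] show "c = u 0" using v by simp
qed

section \<open>The lower bound on the half-line\<close>

text \<open>
  The action along the ray through a point of the Nehari manifold is a multiple of
  \<open>t\<^sup>2 / 2 - t powr (p + 1) / (p + 1)\<close>, which is maximal at \<open>t = 1\<close> by the inequality of Young with exponents
  \<open>(p + 1) / 2\<close> and its conjugate.
\<close>

lemma scaling_exponent_bound:
  fixes t p :: real
  assumes "t > 0" "p > 1"
  shows "t\<^sup>2 / 2 - t powr (p + 1) / (p + 1) \<le> 1 / 2 - 1 / (p + 1)"
proof -
  have one: "2 / (p + 1) + (p - 1) / (p + 1) = 1"
    using assms by (simp add: add_divide_distrib[symmetric])
  then have "(t powr (p + 1)) powr (2 / (p + 1)) * 1 powr ((p - 1) / (p + 1))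
      \<le> 2 / (p + 1) * t powr (p + 1) + (p - 1) / (p + 1) * 1"
    using assms by (intro Youngs_inequality_0) auto
  moreover have "(t powr (p + 1)) powr (2 / (p + 1)) = t\<^sup>2"
  proof -
    have "(t powr (p + 1)) powr (2 / (p + 1)) = t powr ((p + 1) * (2 / (p + 1)))" by (rule powr_powr)
    also have "(p + 1) * (2 / (p + 1)) = 2" using assms by (simp add: field_simps)
    finally show ?thesis using assms by simp
  qed
  ultimately have "t\<^sup>2 \<le> 2 / (p + 1) * t powr (p + 1) + (p - 1) / (p + 1)"
    using assms by simp
  moreover have "2 / (p + 1) * t powr (p + 1) = 2 * (t powr (p + 1) / (p + 1))" "2 / (p + 1) = 2 * (1 / (p + 1))"
    by simp_all
  ultimately show ?thesis using one by linarith
qed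

text \<open>
  The continuous representative \<open>u\<close> of a function in \<open>H\<^sup>1\<close> of the half-line together with its weak derivative
  \<open>g\<close>.
\<close>

definition primitive_pair :: "(real \<Rightarrow> complex) \<Rightarrow> (real \<Rightarrow> complex) \<Rightarrow> bool" where
  "primitive_pair u g \<longleftrightarrow> continuous_on {0..} u \<and> u \<in> L2_half \<and> g \<in> L2_half \<and>
     (\<forall>x y. 0 \<le> x \<longrightarrow> x \<le> y \<longrightarrow> u y - u x = integral {x..y} g)"

lemma half_line_integral_ge_interval:
  fixes k :: "real \<Rightarrow> real"
  assumes i: "integrable half_line k" and k0: "\<And>x. x > 0 \<Longrightarrow> 0 \<le> k x" and "0 \<le> a"
  shows "k integrable_on {a..b}" "integral {a..b} k \<le> (LINT x|half_line. k x)"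
proof -
  have ai: "k absolutely_integrable_on {0<..}" using i by (simp add: integrable_half_line_iff)
  have eq: "(LINT x|half_line. k x) = integral {0<..} k"
    by (rule lebesgue_integral_eq_integral[OF i]) simp
  have "k absolutely_integrable_on {a<..b}"
    using \<open>0 \<le> a\<close> by (intro set_integrable_subset[OF ai]) auto
  then have i1: "k integrable_on {a<..b}" by (simp add: absolutely_integrable_on_def)
  then show i2: "k integrable_on {a..b}"
    by (rule integrable_spike_set) (auto intro: negligible_subset[of "{a}"])
  have "integral {a..b} k = integral {a<..b} k"
    by (rule integral_spike_set) (auto intro: negligible_subset[of "{a}"])
  also have "\<dots> \<le> integral {0<..} k"
    using i1 ai \<open>0 \<le> a\<close> k0 by (intro integral_subset_le) (auto simp: absolutely_integrable_on_def)
  finally show "integral {a..b} k \<le> (LINT x|half_line. k x)" using eq by simp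
qed

lemma primitive_pair_chain_bound:
  fixes G w :: "real \<Rightarrow> real"
  assumes pp: "primitive_pair u g"
    and G: "\<And>s. (G has_real_derivative w s) (at s)" "continuous_on UNIV w"
    and t: "t \<ge> 0" and ab: "0 \<le> a" "a \<le> b"
  shows "\<bar>G (t * cmod (u b)) - G (t * cmod (u a))\<bar> \<le> integral {a..b} (\<lambda>x. \<bar>w (t * cmod (u x))\<bar> * (t * cmod (g x)))"
    and "(\<lambda>x. \<bar>w (t * cmod (u x))\<bar> * (t * cmod (g x))) integrable_on {a..b}"
proof -
  have cu: "continuous_on {a..b} u"
    using pp ab by (auto simp: primitive_pair_def elim: continuous_on_subset)
  have ig: "g absolutely_integrable_on {x..y}" if "0 \<le> x" for x y
    using pp that by (auto simp: primitive_pair_def L2_half_absolutely_integrable)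
  have im: "(\<lambda>x. t * cmod (g x)) absolutely_integrable_on {a..b}"
    using absolutely_integrable_norm[OF ig[OF ab(1), of b]] by (simp add: comp_def)
  have cv: "continuous_on {a..b} (\<lambda>x. t * cmod (u x))" by (intro continuous_intros cu)
  show "\<bar>G (t * cmod (u b)) - G (t * cmod (u a))\<bar> \<le> integral {a..b} (\<lambda>x. \<bar>w (t * cmod (u x))\<bar> * (t * cmod (g x)))"
  proof (rule chain_rule_bound[OF ab(2) im cv _ _ G])
    fix x y assume xy: "a \<le> x" "x \<le> y" "y \<le> b"
    have "\<bar>t * cmod (u y) - t * cmod (u x)\<bar> = t * \<bar>cmod (u y) - cmod (u x)\<bar>"
      using t by (simp add: abs_mult right_diff_distrib[symmetric])
    also have "\<dots> \<le> t * cmod (u y - u x)"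
      by (intro mult_left_mono norm_triangle_ineq3 t)
    also have "u y - u x = integral {x..y} g"
      using pp xy ab by (auto simp: primitive_pair_def)
    also have "t * cmod (integral {x..y} g) \<le> t * integral {x..y} (\<lambda>x. cmod (g x))"
      using ig[of x y] xy ab t
      by (intro mult_left_mono integral_norm_bound_integral) (auto simp: absolutely_integrable_on_def)
    finally show "\<bar>t * cmod (u y) - t * cmod (u x)\<bar> \<le> integral {x..y} (\<lambda>x. t * cmod (g x))"
      by simp
  qed (use t in auto)
  have "continuous_on {a..b} (\<lambda>x. \<bar>w (t * cmod (u x))\<bar>)"
    by (intro continuous_intros continuous_on_compose2[OF G(2) cv]) auto
  from absolutely_integrable_continuous_mult[OF this im]
  show "(\<lambda>x. \<bar>w (t * cmod (u x))\<bar> * (t * cmod (g x))) integrable_on {a..b}"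
    by (simp add: absolutely_integrable_on_def)
qed

text \<open>
  Otherwise \<open>|u|\<^sup>2\<close> would not be integrable. This much decay is enough to
  make the right end of the calibration negligible.
\<close>

lemma primitive_pair_small_value:
  assumes pp: "primitive_pair u g" and "\<epsilon> > 0" "x \<ge> 0"
  shows "\<exists>b\<ge>x. cmod (u b) < \<epsilon>"
proof (rule ccontr)
  assume "\<not> ?thesis"
  then have big: "cmod (u b) \<ge> \<epsilon>" if "b \<ge> x" for b using that by (auto simp: not_less)
  define B where "B = (LINT x|half_line. (cmod (u x))\<^sup>2)"
  have i: "integrable half_line (\<lambda>x. (cmod (u x))\<^sup>2)" using pp by (auto simp: primitive_pair_def L2_half_def)
  obtain n :: nat where n: "real n * \<epsilon>\<^sup>2 > B"
    using ex_less_of_nat_mult[of "\<epsilon>\<^sup>2" B] \<open>\<epsilon> > 0\<close> by auto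
  have "real n * \<epsilon>\<^sup>2 = integral {x..x + real n} (\<lambda>_. \<epsilon>\<^sup>2)" by simp
  also have "\<dots> \<le> integral {x..x + real n} (\<lambda>x. (cmod (u x))\<^sup>2)"
  proof (rule integral_le)
    show "(\<lambda>x. (cmod (u x))\<^sup>2) integrable_on {x..x + real n}"
      by (rule half_line_integral_ge_interval(1)[OF i]) (use \<open>x \<ge> 0\<close> in auto)
    show "\<epsilon>\<^sup>2 \<le> (cmod (u y))\<^sup>2" if "y \<in> {x..x + real n}" for y
      using that big \<open>\<epsilon> > 0\<close> by (intro power_mono) auto
  qed auto
  also have "\<dots> \<le> B"
    unfolding B_def by (rule half_line_integral_ge_interval(2)[OF i]) (use \<open>x \<ge> 0\<close> in auto)
  finally show False using n by simp
qed

text \<open>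
  The chain rule with \<open>G s = s\<^sup>2\<close> compares \<open>|u(x)|\<^sup>2\<close> with a small value of \<open>|u|\<^sup>2\<close> further out.
\<close>

lemma primitive_pair_bounded:
  assumes pp: "primitive_pair u g"
  obtains M where "\<And>x. x \<ge> 0 \<Longrightarrow> cmod (u x) \<le> M"
proof -
  define k where "k x = (cmod (u x))\<^sup>2 + (cmod (g x))\<^sup>2" for x
  have ik: "integrable half_line k"
    unfolding k_def using pp by (auto simp: primitive_pair_def L2_half_def)
  define K where "K = (LINT x|half_line. k x)"
  have "(cmod (u x))\<^sup>2 \<le> 1 + K" if x: "x \<ge> 0" for x
  proof -
    obtain b where b: "b \<ge> x" "cmod (u b) < 1" using primitive_pair_small_value[OF pp _ x, of 1] by auto
    have "\<bar>(1 * cmod (u b))\<^sup>2 - (1 * cmod (u x))\<^sup>2\<bar> \<le> integral {x..b} (\<lambda>x. \<bar>2 * (1 * cmod (u x))\<bar> * (1 * cmod (g x)))"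
      by (rule primitive_pair_chain_bound(1)[OF pp, where G = "\<lambda>s. s\<^sup>2" and w = "\<lambda>s. 2 * s"])
        (use x b in \<open>auto intro!: derivative_eq_intros continuous_intros\<close>)
    also have "\<dots> \<le> integral {x..b} k"
    proof (rule integral_le)
      show "(\<lambda>x. \<bar>2 * (1 * cmod (u x))\<bar> * (1 * cmod (g x))) integrable_on {x..b}"
        by (rule primitive_pair_chain_bound(2)[OF pp, where G = "\<lambda>s. s\<^sup>2" and w = "\<lambda>s. 2 * s"])
        (use x b in \<open>auto intro!: derivative_eq_intros continuous_intros\<close>)
      show "k integrable_on {x..b}"
        by (rule half_line_integral_ge_interval(1)[OF ik]) (use x in \<open>auto simp: k_def\<close>)
      show "\<bar>2 * (1 * cmod (u y))\<bar> * (1 * cmod (g y)) \<le> k y" for y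
        using zero_le_power2[of "cmod (u y) - cmod (g y)"] by (simp add: k_def power2_diff)
    qed
    also have "\<dots> \<le> K"
      unfolding K_def by (rule half_line_integral_ge_interval(2)[OF ik]) (use x in \<open>auto simp: k_def\<close>)
    finally have "(cmod (u x))\<^sup>2 \<le> (cmod (u b))\<^sup>2 + K" by simp
    also have "(cmod (u b))\<^sup>2 \<le> 1" using b by (simp add: power_le_one)
    finally show ?thesis by simp
  qed
  then show ?thesis using that[of "sqrt (1 + K)"] by (metis real_le_rsqrt)
qed

lemma primitive_pair_powr_integrable:
  assumes pp: "primitive_pair u g" and "q \<ge> 2"
  shows "integrable half_line (\<lambda>x. cmod (u x) powr q)"
proof -
  obtain M where M: "\<And>x. x \<ge> 0 \<Longrightarrow> cmod (u x) \<le> M" using primitive_pair_bounded[OF pp] by blast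
  have u: "u \<in> borel_measurable half_line" "integrable half_line (\<lambda>x. (cmod (u x))\<^sup>2)"
    using pp by (auto simp: primitive_pair_def L2_half_def)
  show ?thesis
  proof (rule Bochner_Integration.integrable_bound)
    show "integrable half_line (\<lambda>x. M powr (q - 2) * (cmod (u x))\<^sup>2)" using u by simp
    show "(\<lambda>x. cmod (u x) powr q) \<in> borel_measurable half_line" using u(1) by measurable
    show "AE x in half_line. norm (cmod (u x) powr q) \<le> norm (M powr (q - 2) * (cmod (u x))\<^sup>2)"
    proof (rule AE_I2)
      fix x assume "x \<in> space half_line"
      then have x: "x \<ge> 0" by simp
      have "cmod (u x) powr q = cmod (u x) powr (q - 2) * (cmod (u x))\<^sup>2"
        using powr_add[of "cmod (u x)" "q - 2" 2] by simp
      also have "\<dots> \<le> M powr (q - 2) * (cmod (u x))\<^sup>2"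
        using M[OF x] \<open>q \<ge> 2\<close> by (intro mult_right_mono powr_mono2) auto
      finally show "norm (cmod (u x) powr q) \<le> norm (M powr (q - 2) * (cmod (u x))\<^sup>2)" by simp
    qed
  qed
qed

definition half_action :: "real \<Rightarrow> real \<Rightarrow> real \<Rightarrow> (real \<Rightarrow> complex) \<Rightarrow> (real \<Rightarrow> complex) \<Rightarrow> real" where
  "half_action p \<gamma> \<omega> u g = 1/2 * ((LINT x|half_line. (cmod (g x))\<^sup>2) + \<gamma> * (cmod (u 0))\<^sup>2 + \<omega> * (LINT x|half_line. (cmod (u x))\<^sup>2))
     - 1 / (p + 1) * (LINT x|half_line. cmod (u x) powr (p + 1))"

definition half_nehari :: "real \<Rightarrow> real \<Rightarrow> real \<Rightarrow> (real \<Rightarrow> complex) \<Rightarrow> (real \<Rightarrow> complex) \<Rightarrow> real" where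
  "half_nehari p \<gamma> \<omega> u g = (LINT x|half_line. (cmod (g x))\<^sup>2) + \<gamma> * (cmod (u 0))\<^sup>2 + \<omega> * (LINT x|half_line. (cmod (u x))\<^sup>2)
     - (LINT x|half_line. cmod (u x) powr (p + 1))"

text \<open>
  The parameters on one edge: \<open>\<gamma>\<close> is the strength of the boundary condition \<open>\<phi>'(0) = \<gamma> \<phi>(0)\<close>, and
  \<open>\<gamma>\<^sup>2 < \<omega>\<close> is what makes the soliton exist.
\<close>

locale delta_soliton =
  fixes p \<gamma> \<omega> :: real
  assumes p: "p > 1" and \<gamma>\<omega>: "\<gamma>\<^sup>2 < \<omega>"
begin

lemma \<omega>_pos: "\<omega> > 0" using \<gamma>\<omega> zero_le_power2[of \<gamma>] by linarith

text \<open>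
  The first integral of \<open>\<phi>'' = \<omega> \<phi> - \<phi> powr p\<close> for solutions vanishing at infinity is \<open>(\<phi>')\<^sup>2 = W \<phi>\<close>.
  Taking \<open>|s|\<close> here and the positive part below makes \<open>sqrt W\<close> continuous on the whole line, so that it has a
  global primitive \<open>G\<close>.
\<close>

definition W :: "real \<Rightarrow> real" where
  "W s = \<omega> * s\<^sup>2 - 2 / (p + 1) * \<bar>s\<bar> powr (p + 1)"

definition w :: "real \<Rightarrow> real" where
  "w s = sqrt (max 0 (W s))"

definition G :: "real \<Rightarrow> real" where
  "G = (SOME F. (\<forall>s. (F has_real_derivative w s) (at s)) \<and> F 0 = 0)"

text \<open>
  The positive zero of \<open>W\<close>, and the maximum of the soliton on the whole line.
\<close>

definition U :: real where
  "U = ((p + 1) / 2 * \<omega>) powr (1 / (p - 1))"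

text \<open>
  The positive solution of \<open>W s = \<gamma>\<^sup>2 s\<^sup>2\<close>, which the boundary condition forces on the value of the soliton
  at \<open>0\<close>.
\<close>

definition \<phi>0 :: real where
  "\<phi>0 = ((p + 1) / 2 * (\<omega> - \<gamma>\<^sup>2)) powr (1 / (p - 1))"

text \<open>
  The value of \<open>\<integral> (\<phi>')\<^sup>2\<close>: for \<open>\<gamma> < 0\<close> the profile decreases from \<open>\<phi>0\<close>, for \<open>\<gamma> \<ge> 0\<close> it first rises
  from \<open>\<phi>0\<close> to \<open>U\<close>.
\<close>

definition half_energy :: real where
  "half_energy = (if \<gamma> < 0 then G \<phi>0 else 2 * G U - G \<phi>0)"

lemma w_continuous: "continuous_on UNIV w"
proof -
  have "continuous_on UNIV (\<lambda>s::real. \<bar>s\<bar> powr (p + 1))"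
  proof (rule continuous_on_powr')
  qed (use p in \<open>auto intro!: continuous_intros\<close>)
  then show ?thesis
    unfolding w_def[abs_def] W_def
    by (intro continuous_on_real_sqrt continuous_on_max continuous_on_const continuous_on_diff
      continuous_on_mult continuous_on_power continuous_on_id)
qed

lemma G_DERIV: "(G has_real_derivative w s) (at s)" and G_0: "G 0 = 0"
proof -
  have "\<exists>F. (\<forall>s. (F has_real_derivative w s) (at s)) \<and> F 0 = 0"
    using real_antiderivative[OF w_continuous, of 0] by blast
  then have "(\<forall>s. (G has_real_derivative w s) (at s)) \<and> G 0 = 0"
    unfolding G_def by (rule someI_ex)
  then show "(G has_real_derivative w s) (at s)" "G 0 = 0" by auto
qed

lemma w_nonneg: "w s \<ge> 0" by (simp add: w_def)

lemma G_mono: "a \<le> b \<Longrightarrow> G a \<le> G b"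
  by (rule DERIV_nonneg_imp_nondecreasing, assumption, intro exI conjI, rule G_DERIV, rule w_nonneg)

lemma G_isCont: "isCont G s"
  by (rule DERIV_isCont[OF G_DERIV])

lemma W_factor:
  assumes "s > 0" shows "W s = 2 / (p + 1) * s\<^sup>2 * ((p + 1) / 2 * \<omega> - s powr (p - 1))"
proof -
  have "s powr (p + 1) = s powr (p - 1) * s powr 2" by (simp add: powr_add[symmetric] add.commute)
  then have "s powr (p + 1) = s powr (p - 1) * s\<^sup>2" using assms by simp
  then show ?thesis using assms p by (simp add: W_def field_simps)
qed

lemma U_powr: "U powr (p - 1) = (p + 1) / 2 * \<omega>" and U_pos: "U > 0"
  using p \<omega>_pos by (simp_all add: U_def powr_powr)

lemma \<phi>0_powr: "\<phi>0 powr (p - 1) = (p + 1) / 2 * (\<omega> - \<gamma>\<^sup>2)" and \<phi>0_pos: "\<phi>0 > 0"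
  using p \<gamma>\<omega> by (simp_all add: \<phi>0_def powr_powr)

lemma \<phi>0_le_U: "\<phi>0 \<le> U"
  unfolding \<phi>0_def U_def using p \<gamma>\<omega> by (intro powr_mono2) auto

lemma W_nonneg:
  assumes "0 \<le> s" "s \<le> U" shows "W s \<ge> 0"
proof (cases "s = 0")
  case True then show ?thesis using p by (simp add: W_def)
next
  case False
  then have "s powr (p - 1) \<le> U powr (p - 1)" using assms p by (intro powr_mono2) auto
  then show ?thesis using False assms p by (subst W_factor) (auto simp: U_powr)
qed

lemma w_square:
  assumes "0 \<le> s" "s \<le> U" shows "(w s)\<^sup>2 = W s"
  using W_nonneg[OF assms] by (simp add: w_def)

lemma w_ge:
  assumes "0 < s" "s \<le> \<phi>0" shows "w s \<ge> \<bar>\<gamma>\<bar> * s"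
proof -
  have "s powr (p - 1) \<le> \<phi>0 powr (p - 1)" using assms p by (intro powr_mono2) auto
  then have "2 / (p + 1) * s\<^sup>2 * ((p + 1) / 2 * \<gamma>\<^sup>2) \<le> W s"
    using p unfolding W_factor[OF assms(1)] by (intro mult_left_mono) (auto simp: \<phi>0_powr field_simps)
  also have "2 / (p + 1) * s\<^sup>2 * ((p + 1) / 2 * \<gamma>\<^sup>2) = (\<bar>\<gamma>\<bar> * s)\<^sup>2"
    using p by (simp add: power_mult_distrib)
  finally show ?thesis unfolding w_def by (intro real_le_rsqrt) auto
qed

lemma w_le:
  assumes "\<phi>0 \<le> s" shows "w s \<le> \<bar>\<gamma>\<bar> * s"
proof -
  have s: "s > 0" using assms \<phi>0_pos by simp
  have "\<phi>0 powr (p - 1) \<le> s powr (p - 1)" using assms p \<phi>0_pos by (intro powr_mono2) auto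
  then have "W s \<le> 2 / (p + 1) * s\<^sup>2 * ((p + 1) / 2 * \<gamma>\<^sup>2)"
    using p unfolding W_factor[OF s] by (intro mult_left_mono) (auto simp: \<phi>0_powr field_simps)
  also have "2 / (p + 1) * s\<^sup>2 * ((p + 1) / 2 * \<gamma>\<^sup>2) = (\<bar>\<gamma>\<bar> * s)\<^sup>2"
    using p by (simp add: power_mult_distrib)
  finally show ?thesis unfolding w_def using s by (intro real_le_lsqrt) auto
qed

text \<open>
  The derivative \<open>\<gamma> s - w s\<close> changes sign from negative to positive at \<open>\<phi>0\<close>.
\<close>

lemma boundary_term_minimal:
  assumes "\<gamma> \<ge> 0" "0 \<le> s"
  shows "\<gamma> / 2 * \<phi>0\<^sup>2 - G \<phi>0 \<le> \<gamma> / 2 * s\<^sup>2 - G s"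
proof -
  have D: "((\<lambda>s. \<gamma> / 2 * s\<^sup>2 - G s) has_real_derivative \<gamma> * s - w s) (at s)" for s
    by (auto intro!: derivative_eq_intros G_DERIV)
  show ?thesis
  proof (cases "s \<le> \<phi>0")
    case True
    show ?thesis
    proof (rule DERIV_nonpos_imp_nonincreasing[OF True, where f = "\<lambda>s. \<gamma> / 2 * s\<^sup>2 - G s"])
      fix x assume x: "s \<le> x" "x \<le> \<phi>0"
      have "\<gamma> * x - w x \<le> 0"
        using w_ge[of x] x assms w_nonneg[of x] by (cases "x = 0") auto
      then show "\<exists>y. ((\<lambda>s. \<gamma> / 2 * s\<^sup>2 - G s) has_real_derivative y) (at x) \<and> y \<le> 0"
        using D by blast
    qed
  next
    case False
    show ?thesis
    proof (rule DERIV_nonneg_imp_nondecreasing[where f = "\<lambda>s. \<gamma> / 2 * s\<^sup>2 - G s"])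
      show "\<phi>0 \<le> s" using False by simp
      fix x assume x: "\<phi>0 \<le> x" "x \<le> s"
      have "\<gamma> * x - w x \<ge> 0" using w_le[of x] x assms by simp
      then show "\<exists>y. ((\<lambda>s. \<gamma> / 2 * s\<^sup>2 - G s) has_real_derivative y) (at x) \<and> y \<ge> 0"
        using D by blast
    qed
  qed
qed

text \<open>
  The calibration inequality on \<open>[0, x]\<close> and on \<open>[x, b]\<close>, with \<open>|u b|\<close> as small as desired. The right-hand
  side is the action of \<open>t u\<close> without its boundary term.
\<close>

lemma profile_energy_bound:
  assumes pp: "primitive_pair u g" and t: "t > 0" and le: "\<And>x. x \<ge> 0 \<Longrightarrow> t * cmod (u x) \<le> U"
    and x: "x \<ge> 0"
  shows "2 * G (t * cmod (u x)) - G (t * cmod (u 0)) \<le>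
    t\<^sup>2 / 2 * ((LINT x|half_line. (cmod (g x))\<^sup>2) + \<omega> * (LINT x|half_line. (cmod (u x))\<^sup>2))
     - t powr (p + 1) / (p + 1) * (LINT x|half_line. cmod (u x) powr (p + 1))"
    (is "_ \<le> ?R")
proof (rule field_le_epsilon)
  fix \<epsilon> :: real assume \<epsilon>: "\<epsilon> > 0"
  \<comment> \<open>the energy density of \<open>t u\<close>, non-negative because \<open>t |u| \<le> U\<close>\<close>
  define k where "k x = ((t * cmod (g x))\<^sup>2 + W (t * cmod (u x))) / 2" for x
  have k_eq: "k x = t\<^sup>2 / 2 * (cmod (g x))\<^sup>2 + t\<^sup>2 / 2 * \<omega> * (cmod (u x))\<^sup>2 - t powr (p + 1) / (p + 1) * (cmod (u x) powr (p + 1))" for x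
    using t by (simp add: k_def W_def power_mult_distrib powr_mult abs_mult field_simps)
  have i: "integrable half_line (\<lambda>x. (cmod (g x))\<^sup>2)" "integrable half_line (\<lambda>x. (cmod (u x))\<^sup>2)"
    "integrable half_line (\<lambda>x. cmod (u x) powr (p + 1))"
    using pp primitive_pair_powr_integrable[OF pp, of "p + 1"] p by (auto simp: primitive_pair_def L2_half_def)
  have ik: "integrable half_line k"
    unfolding k_eq[abs_def] using i by auto
  have kR: "(LINT x|half_line. k x) = ?R"
    unfolding k_eq[abs_def] using i by (simp add: algebra_simps)
  have k0: "k x \<ge> 0" if "x \<ge> 0" for x
    using W_nonneg[of "t * cmod (u x)"] le[OF that] t by (simp add: k_def)
  have seg: "\<bar>G (t * cmod (u b)) - G (t * cmod (u a))\<bar> \<le> integral {a..b} k" if ab: "0 \<le> a" "a \<le> b" for a b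
  proof -
    note cb = primitive_pair_chain_bound[OF pp G_DERIV w_continuous less_imp_le[OF t] ab]
    show ?thesis
    proof (rule order_trans[OF cb(1)], rule integral_le[OF cb(2)])
      show "k integrable_on {a..b}"
        by (rule half_line_integral_ge_interval(1)[OF ik]) (use ab k0 in auto)
      fix y assume y: "y \<in> {a..b}"
      have "(w (t * cmod (u y)))\<^sup>2 = W (t * cmod (u y))"
        using y ab t le[of y] by (intro w_square) auto
      then show "\<bar>w (t * cmod (u y))\<bar> * (t * cmod (g y)) \<le> k y"
        using zero_le_power2[of "w (t * cmod (u y)) - t * cmod (g y)"] w_nonneg[of "t * cmod (u y)"]
        by (simp add: k_def power2_diff)
    qed
  qed
  have "\<exists>\<delta>>0. \<forall>s. dist s 0 < \<delta> \<longrightarrow> dist (G s) (G 0) < \<epsilon>"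
    using G_isCont[of 0] \<epsilon> unfolding continuous_at_eps_delta by simp
  then obtain \<delta> where \<delta>: "\<delta> > 0" "\<And>s. \<bar>s\<bar> < \<delta> \<Longrightarrow> \<bar>G s\<bar> < \<epsilon>"
    by (auto simp: G_0)
  have dt: "\<delta> / t > 0" using \<delta>(1) t by simp
  obtain b where b: "b \<ge> x" "cmod (u b) < \<delta> / t"
    using primitive_pair_small_value[OF pp dt x] by blast
  have Gb: "G (t * cmod (u b)) < \<epsilon>"
    using \<delta>(2)[of "t * cmod (u b)"] b t by (simp add: abs_mult field_simps)
  have "2 * G (t * cmod (u x)) - G (t * cmod (u 0)) - G (t * cmod (u b))
      \<le> integral {0..x} k + integral {x..b} k"
    using seg[of 0 x] seg[of x b] x b by linarith
  also have "\<dots> = integral {0..b} k"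
    by (rule Henstock_Kurzweil_Integration.integral_combine[OF x b(1)])
      (rule half_line_integral_ge_interval(1)[OF ik], use k0 in auto)
  also have "\<dots> \<le> ?R"
    unfolding kR[symmetric] by (rule half_line_integral_ge_interval(2)[OF ik]) (use k0 in auto)
  finally show "2 * G (t * cmod (u x)) - G (t * cmod (u 0)) \<le> ?R + \<epsilon>" using Gb by linarith
qed

text \<open>
  The choice of the multiple \<open>t u\<close> is the heart of the matter: it must not exceed \<open>U\<close>, where the calibration
  breaks down, and it must either reach \<open>U\<close> or have boundary value \<open>\<phi>0\<close>.
\<close>

lemma half_action_lower_bound:
  assumes pp: "primitive_pair u g" and nz: "x0 \<ge> 0" "u x0 \<noteq> 0" and I: "half_nehari p \<gamma> \<omega> u g = 0"
  shows "half_energy + \<gamma> / 2 * \<phi>0\<^sup>2 \<le> half_action p \<gamma> \<omega> u g"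
proof -
  define A where "A = (LINT x|half_line. (cmod (g x))\<^sup>2)"
  define B where "B = (LINT x|half_line. (cmod (u x))\<^sup>2)"
  define C where "C = (LINT x|half_line. cmod (u x) powr (p + 1))"
  have ABC: "A + \<gamma> * (cmod (u 0))\<^sup>2 + \<omega> * B = C"
    using I unfolding half_nehari_def A_def B_def C_def by linarith
  have C0: "C \<ge> 0"
    unfolding C_def by (rule Bochner_Integration.integral_nonneg) simp
  define K where "K t = t\<^sup>2 / 2 * (A + \<omega> * B) - t powr (p + 1) / (p + 1) * C" for t
  have action: "K t + \<gamma> / 2 * (t * cmod (u 0))\<^sup>2 \<le> half_action p \<gamma> \<omega> u g" if "t > 0" for t
  proof -
    have "K t + \<gamma> / 2 * (t * cmod (u 0))\<^sup>2 = t\<^sup>2 / 2 * (A + \<gamma> * (cmod (u 0))\<^sup>2 + \<omega> * B) - t powr (p + 1) / (p + 1) * C"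
      by (simp add: K_def power_mult_distrib algebra_simps)
    also have "\<dots> = (t\<^sup>2 / 2 - t powr (p + 1) / (p + 1)) * C"
      unfolding ABC by (simp add: algebra_simps)
    also have "\<dots> \<le> (1 / 2 - 1 / (p + 1)) * C"
      by (intro mult_right_mono scaling_exponent_bound that p C0)
    also have "\<dots> = half_action p \<gamma> \<omega> u g"
      unfolding half_action_def A_def[symmetric] B_def[symmetric] C_def[symmetric] ABC by (simp add: algebra_simps)
    finally show ?thesis .
  qed
  define M where "M = Sup ((\<lambda>x. cmod (u x)) ` {0..})"
  obtain M0 where "\<And>x. x \<ge> 0 \<Longrightarrow> cmod (u x) \<le> M0" using primitive_pair_bounded[OF pp] by blast
  then have bdd: "bdd_above ((\<lambda>x. cmod (u x)) ` {0..})" by (intro bdd_aboveI2) auto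
  have uM: "cmod (u x) \<le> M" if "x \<ge> 0" for x
    unfolding M_def using that by (intro cSup_upper bdd) auto
  have M: "M > 0" using uM[OF nz(1)] nz(2) by (smt (verit) zero_less_norm_iff)
  \<comment> \<open>the multiple with supremum \<open>U\<close>\<close>
  define t1 where "t1 = U / M"
  have t1: "t1 > 0" using M U_pos by (simp add: t1_def)
  have t1_le: "t1 * cmod (u x) \<le> U" if "x \<ge> 0" for x
    using mult_left_mono[OF uM[OF that], of t1] t1 M by (simp add: t1_def)
  note peb = profile_energy_bound[OF pp, folded A_def B_def C_def, folded K_def]
  have top: "2 * G U - G (t1 * cmod (u 0)) \<le> K t1"
  proof (rule field_le_epsilon)
    fix \<epsilon> :: real assume \<epsilon>: "\<epsilon> > 0"
    have "\<exists>\<delta>>0. \<forall>s. dist s U < \<delta> \<longrightarrow> dist (G s) (G U) < \<epsilon> / 2"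
      using G_isCont[of U] half_gt_zero[OF \<epsilon>] unfolding continuous_at_eps_delta by blast
    then obtain \<delta> where \<delta>: "\<delta> > 0" "\<And>s. \<bar>s - U\<bar> < \<delta> \<Longrightarrow> \<bar>G s - G U\<bar> < \<epsilon> / 2"
      by (auto simp: dist_real_def)
    have "M - \<delta> / t1 < M" using \<delta> t1 by simp
    then obtain x where x: "x \<ge> 0" "M - \<delta> / t1 < cmod (u x)"
      unfolding M_def using less_cSup_iff[OF _ bdd] by auto
    have "U - \<delta> < t1 * cmod (u x)"
      using mult_strict_left_mono[OF x(2) t1] M t1 U_pos by (simp add: t1_def right_diff_distrib)
    then have "\<bar>G (t1 * cmod (u x)) - G U\<bar> < \<epsilon> / 2" using t1_le[OF x(1)] by (intro \<delta>(2)) auto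
    then show "2 * G U - G (t1 * cmod (u 0)) \<le> K t1 + \<epsilon>"
      using peb[OF t1 t1_le x(1)] by linarith
  qed
  define s where "s = t1 * cmod (u 0)"
  have s: "0 \<le> s" "s \<le> U" using t1 t1_le[of 0] by (auto simp: s_def)
  show ?thesis
  proof (cases "\<gamma> < 0")
    case False
    then show ?thesis
      using boundary_term_minimal[of s] s top action[OF t1] unfolding half_energy_def s_def[symmetric] by simp
  next
    case neg: True
    show ?thesis
    proof (cases "s \<le> \<phi>0")
      case True
      have "G s \<le> G \<phi>0" "G \<phi>0 \<le> G U" using G_mono True \<phi>0_le_U by auto
      moreover have "\<gamma> / 2 * \<phi>0\<^sup>2 \<le> \<gamma> / 2 * s\<^sup>2"
        using True s neg power_mono[of s \<phi>0 2] by (simp add: mult_left_mono_neg)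
      ultimately have "G \<phi>0 + \<gamma> / 2 * \<phi>0\<^sup>2 \<le> half_action p \<gamma> \<omega> u g"
        using top[folded s_def] action[OF t1, folded s_def] by linarith
      then show ?thesis using neg by (simp add: half_energy_def)
    next
      case False
      then have u0: "cmod (u 0) > 0" using \<phi>0_pos by (auto simp: s_def)
      \<comment> \<open>here \<open>t1 |u(0)| > \<phi>0\<close>, so the multiple with boundary value \<open>\<phi>0\<close> is smaller than \<open>t1 u\<close> and stays
        below \<open>U\<close>; the energy bound is then used at \<open>x = 0\<close>\<close>
      define t where "t = \<phi>0 / cmod (u 0)"
      have t: "t > 0" "t * cmod (u 0) = \<phi>0" using u0 \<phi>0_pos by (auto simp: t_def)
      have "t \<le> t1" using False u0 by (simp add: t_def s_def field_simps)
      then have le: "t * cmod (u x) \<le> U" if "x \<ge> 0" for x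
        using t1_le[OF that] mult_right_mono[of t t1 "cmod (u x)"] by simp
      have "G \<phi>0 \<le> K t" using peb[OF t(1) le, of 0] t(2) by simp
      then show ?thesis using action[OF t(1)] neg t(2) unfolding half_energy_def by simp
    qed
  qed
qed

end

section \<open>The soliton profile\<close>

lemma has_integral_Ioc_iff_Icc:
  fixes f :: "real \<Rightarrow> real"
  shows "(f has_integral y) {a<..b} \<longleftrightarrow> (f has_integral y) {a..b}"
  by (rule has_integral_spike_set_eq) (auto intro: negligible_subset[of "{a}"])

text \<open>
  Fundamental theorem of calculus up to infinity, for integrands that may change sign.
\<close>

lemma half_line_integral_from:
  fixes f F :: "real \<Rightarrow> real"
  assumes i: "integrable half_line f" and a: "a \<ge> 0"
    and F: "\<And>x. x \<ge> a \<Longrightarrow> (F has_real_derivative f x) (at x)"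
    and l: "(F \<longlongrightarrow> l) at_top"
  shows "integral {a<..} f = l - F a"
proof -
  have ai: "f absolutely_integrable_on {a<..}"
    using i unfolding integrable_half_line_iff by (rule set_integrable_subset) (use a in auto)
  define h where "h n x = (if x \<in> {a..a + real n} then f x else 0)" for n x
  have "(f has_integral F (a + real n) - F a) {a..a + real n}" for n
    using F by (intro fundamental_theorem_of_calculus)
      (auto simp: has_real_derivative_iff_has_vector_derivative[symmetric] intro: DERIV_subset)
  then have hi: "(f has_integral F (a + real n) - F a) {a<..a + real n}" for n
    by (simp add: has_integral_Ioc_iff_Icc)
  have hn: "(h n has_integral F (a + real n) - F a) {a<..}" for n
  proof -
    have "((\<lambda>x. if x \<in> {a<..a + real n} then f x else 0) has_integral F (a + real n) - F a) {a<..}"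
      by (subst has_integral_restrict) (use hi in auto)
    then show ?thesis by (rule has_integral_eq[rotated]) (auto simp: h_def)
  qed
  have "(\<lambda>n. integral {a<..} (h n)) \<longlonglongrightarrow> integral {a<..} f"
  proof (rule dominated_convergence(2))
    show "h n integrable_on {a<..}" for n using hn by blast
    show "(\<lambda>x. norm (f x)) integrable_on {a<..}" using ai by (simp add: absolutely_integrable_on_def)
    show "norm (h n x) \<le> norm (f x)" for n x by (simp add: h_def)
    fix x assume x: "x \<in> {a<..}"
    obtain k where k: "x - a \<le> real k" using real_arch_simple by blast
    have "eventually (\<lambda>n. h n x = f x) sequentially"
      using eventually_ge_at_top[of k] by eventually_elim (use k x in \<open>auto simp: h_def\<close>)
    then show "(\<lambda>n. h n x) \<longlonglongrightarrow> f x" by (rule tendsto_eventually)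
  qed
  moreover have "integral {a<..} (h n) = F (a + real n) - F a" for n using hn by blast
  moreover have "(\<lambda>n. F (a + real n) - F a) \<longlonglongrightarrow> l - F a"
    by (intro tendsto_diff tendsto_const filterlim_compose[OF l]
      filterlim_tendsto_add_at_top[OF tendsto_const] filterlim_real_sequentially)
  ultimately show ?thesis using LIMSEQ_unique by auto
qed

lemma exponential_decay_L2_half:
  fixes f :: "real \<Rightarrow> real"
  assumes c: "continuous_on UNIV f" and b: "b > 0"
    and le: "\<And>x. x > 0 \<Longrightarrow> \<bar>f x\<bar> \<le> D * exp (- b * x)"
  shows "(\<lambda>x. complex_of_real (f x)) \<in> L2_half"
proof -
  have m: "f \<in> borel_measurable half_line"
    using continuous_on_subset[OF c] by (intro continuous_imp_measurable_on_sets_lebesgue) auto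
  have e: "integrable half_line (\<lambda>x. exp (- (2 * b) * x))"
  proof -
    have "(\<lambda>x. exp (- (2 * b) * x)) integrable_on {0..}"
      using b by (intro integrable_on_exp_minus_to_infinity) auto
    then have "(\<lambda>x. exp (- (2 * b) * x)) absolutely_integrable_on {0..}"
      by (intro nonnegative_absolutely_integrable_1) auto
    then show ?thesis unfolding integrable_half_line_iff by (rule set_integrable_subset) auto
  qed
  have "integrable half_line (\<lambda>x. (f x)\<^sup>2)"
  proof (rule Bochner_Integration.integrable_bound)
    show "integrable half_line (\<lambda>x. D\<^sup>2 * exp (- (2 * b) * x))" using e by simp
    show "AE x in half_line. norm ((f x)\<^sup>2) \<le> norm (D\<^sup>2 * exp (- (2 * b) * x))"
    proof (rule AE_I2)
      fix x assume "x \<in> space half_line"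
      then have "\<bar>f x\<bar> \<le> D * exp (- b * x)" using le by simp
      then have "\<bar>f x\<bar>\<^sup>2 \<le> (D * exp (- b * x))\<^sup>2" by (rule power_mono) simp
      also have "\<dots> = D\<^sup>2 * exp (- (2 * b) * x)"
        by (simp add: power_mult_distrib exp_double[symmetric] mult.assoc)
      finally show "norm ((f x)\<^sup>2) \<le> norm (D\<^sup>2 * exp (- (2 * b) * x))" by simp
    qed
  qed (use m in measurable)
  then show ?thesis using m by (auto simp: L2_half_def)
qed

lemma tanh_artanh_real:
  fixes x :: real assumes "\<bar>x\<bar> < 1" shows "tanh (artanh x) = x"
proof -
  have "(1 + x) / (1 - x) > 0" using assms by (auto simp: abs_less_iff)
  then have e: "exp (- 2 * artanh x) = (1 - x) / (1 + x)"
    by (simp add: artanh_def exp_minus)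
  show ?thesis
    unfolding tanh_real_altdef e using assms by (simp add: field_simps abs_less_iff)
qed

context delta_soliton
begin

definition \<alpha> :: real where "\<alpha> = (p - 1) * sqrt \<omega> / 2"
definition c :: real where "c = artanh (\<gamma> / sqrt \<omega>)"
definition T :: "real \<Rightarrow> real" where "T x = tanh (\<alpha> * x - c)"
definition \<phi> :: "real \<Rightarrow> real" where "\<phi> x = U * cosh (\<alpha> * x - c) powr (- 2 / (p - 1))"
definition \<phi>' :: "real \<Rightarrow> real" where "\<phi>' x = - sqrt \<omega> * T x * \<phi> x"

lemma \<alpha>_pos: "\<alpha> > 0" using p \<omega>_pos by (simp add: \<alpha>_def)

lemma T_0: "T 0 = - \<gamma> / sqrt \<omega>"
proof -
  have "\<bar>\<gamma>\<bar> < sqrt \<omega>" using \<gamma>\<omega> by (intro real_less_rsqrt) auto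
  then have "\<bar>\<gamma> / sqrt \<omega>\<bar> < 1" using \<omega>_pos by (simp add: abs_divide)
  then show ?thesis by (simp add: T_def c_def tanh_artanh_real)
qed

lemma T_square: "1 - (T x)\<^sup>2 = 1 / (cosh (\<alpha> * x - c))\<^sup>2"
  by (simp add: T_def tanh_def power_divide sinh_square_eq diff_divide_distrib)

lemma T_abs_le: "\<bar>T x\<bar> \<le> 1"
  unfolding T_def using tanh_real_bounds[of "\<alpha> * x - c"] by auto

lemma T_sign: "T x \<ge> 0 \<longleftrightarrow> \<alpha> * x \<ge> c" "T x \<le> 0 \<longleftrightarrow> \<alpha> * x \<le> c"
  unfolding T_def by simp_all

lemma \<phi>_pos: "\<phi> x > 0"
  using U_pos cosh_real_pos[of "\<alpha> * x - c"] by (simp add: \<phi>_def)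

lemma \<phi>_DERIV: "(\<phi> has_real_derivative \<phi>' x) (at x)"
proof -
  define y where "y = \<alpha> * x - c"
  define r where "r = - 2 / (p - 1)"
  have C: "cosh y > 0" by simp
  have "((\<lambda>x. \<alpha> * x - c) has_real_derivative \<alpha>) (at x)"
    by (auto intro!: derivative_eq_intros)
  then have "((\<lambda>x. cosh (\<alpha> * x - c)) has_real_derivative sinh y * \<alpha>) (at x)"
    unfolding y_def by (auto intro!: derivative_eq_intros)
  moreover have "((\<lambda>z. z powr r) has_real_derivative r * cosh y powr (r - 1)) (at (cosh (\<alpha> * x - c)))"
    using has_real_derivative_powr[OF C, of r] by (simp add: y_def)
  ultimately have "((\<lambda>x. cosh (\<alpha> * x - c) powr r) has_real_derivative r * cosh y powr (r - 1) * (sinh y * \<alpha>)) (at x)"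
    by (rule DERIV_chain2[where f = "\<lambda>z. z powr r", rotated])
  then have "((\<lambda>x. U * cosh (\<alpha> * x - c) powr r) has_real_derivative U * (r * cosh y powr (r - 1) * (sinh y * \<alpha>))) (at x)"
    by (rule DERIV_cmult)
  moreover have "U * (r * cosh y powr (r - 1) * (sinh y * \<alpha>)) = \<phi>' x"
  proof -
    have "cosh y powr (r - 1) = cosh y powr r / cosh y" using C by (simp add: powr_diff)
    then have "U * (r * cosh y powr (r - 1) * (sinh y * \<alpha>)) = (r * \<alpha>) * (sinh y / cosh y) * (U * cosh y powr r)"
      by simp
    also have "r * \<alpha> = - sqrt \<omega>" using p by (simp add: r_def \<alpha>_def field_simps)
    finally show ?thesis by (simp add: \<phi>'_def \<phi>_def T_def tanh_def y_def r_def)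
  qed
  ultimately show ?thesis by (simp add: \<phi>_def[abs_def] r_def)
qed

lemma T_DERIV: "(T has_real_derivative \<alpha> * (1 - (T x)\<^sup>2)) (at x)"
  unfolding T_def[abs_def] by (auto intro!: derivative_eq_intros)

lemma \<phi>'_DERIV:
  "(\<phi>' has_real_derivative - sqrt \<omega> * (\<alpha> * (1 - (T x)\<^sup>2) * \<phi> x + \<phi>' x * T x)) (at x)"
  using DERIV_cmult[OF DERIV_mult[OF T_DERIV \<phi>_DERIV], of "- sqrt \<omega>" x]
  by (simp add: \<phi>'_def[abs_def] mult.assoc)

lemma \<phi>_continuous: "continuous_on A \<phi>"
  by (meson \<phi>_DERIV DERIV_continuous continuous_at_imp_continuous_on)

lemma \<phi>'_continuous: "continuous_on A \<phi>'"
proof -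
  have "continuous_on A T"
    by (meson T_DERIV DERIV_continuous continuous_at_imp_continuous_on)
  then show ?thesis unfolding \<phi>'_def[abs_def] by (intro continuous_intros \<phi>_continuous)
qed

lemma \<phi>_powr: "\<phi> x powr (p - 1) = (p + 1) / 2 * \<omega> * (1 - (T x)\<^sup>2)"
proof -
  have "\<phi> x powr (p - 1) = U powr (p - 1) * cosh (\<alpha> * x - c) powr (- 2)"
  proof -
    have e: "- 2 / (p - 1) * (p - 1) = - 2" using p by (simp add: field_simps)
    show ?thesis unfolding \<phi>_def powr_mult powr_powr e ..
  qed
  also have "cosh (\<alpha> * x - c) powr (- 2) = 1 - (T x)\<^sup>2"
    by (simp add: T_square powr_minus inverse_eq_divide)
  finally show ?thesis by (simp add: U_powr)
qed

lemma W_\<phi>: "W (\<phi> x) = (\<phi>' x)\<^sup>2"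
  unfolding W_factor[OF \<phi>_pos] \<phi>_powr \<phi>'_def using p \<omega>_pos
  by (simp add: power_mult_distrib field_simps)

lemma w_\<phi>: "w (\<phi> x) = \<bar>\<phi>' x\<bar>"
  by (simp add: w_def W_\<phi>)

lemma \<phi>_0: "\<phi> 0 = \<phi>0"
proof -
  have "\<phi> 0 powr (p - 1) = \<phi>0 powr (p - 1)"
    using \<omega>_pos by (simp add: \<phi>_powr \<phi>0_powr T_0 power_divide field_simps)
  then have "(\<phi> 0 powr (p - 1)) powr (1 / (p - 1)) = (\<phi>0 powr (p - 1)) powr (1 / (p - 1))" by simp
  then show ?thesis using p \<phi>_pos[of 0] \<phi>0_pos by (simp add: powr_powr)
qed

lemma \<phi>'_0: "\<phi>' 0 = \<gamma> * \<phi>0"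
  using \<omega>_pos by (simp add: \<phi>'_def T_0 \<phi>_0)

lemma \<phi>_decay: "\<exists>D. \<forall>x. \<phi> x \<le> D * exp (- sqrt \<omega> * x)"
proof (intro exI allI)
  fix x
  define r where "r = - 2 / (p - 1)"
  have r: "r \<le> 0" "\<alpha> * r = - sqrt \<omega>" using p by (auto simp: r_def \<alpha>_def field_simps)
  have "exp (\<alpha> * x) * (exp (- c) / 2) \<le> cosh (\<alpha> * x - c)"
    by (simp add: cosh_def exp_diff exp_minus field_simps)
  then have "cosh (\<alpha> * x - c) powr r \<le> (exp (\<alpha> * x) * (exp (- c) / 2)) powr r"
    using r by (intro powr_mono2') auto
  also have "\<dots> = exp (- sqrt \<omega> * x) * (exp (- c) / 2) powr r"
  proof -
    have "\<alpha> * x * r = - sqrt \<omega> * x"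
      using arg_cong[OF r(2), of "\<lambda>z. z * x"] by (simp add: mult_ac)
    then show ?thesis unfolding powr_mult[of "exp (\<alpha> * x)"] exp_powr_real by simp
  qed
  finally have "U * cosh (\<alpha> * x - c) powr r \<le> U * (exp (- sqrt \<omega> * x) * (exp (- c) / 2) powr r)"
    using U_pos by (intro mult_left_mono) auto
  then show "\<phi> x \<le> (U * (exp (- c) / 2) powr (- 2 / (p - 1))) * exp (- sqrt \<omega> * x)"
    by (simp add: \<phi>_def r_def mult_ac)
qed

lemma \<phi>_tendsto_0: "(\<phi> \<longlongrightarrow> 0) at_top"
proof -
  obtain D where D: "\<And>x. \<phi> x \<le> D * exp (- sqrt \<omega> * x)" using \<phi>_decay by blast
  have "sqrt \<omega> > 0" using \<omega>_pos by simp
  then have "((\<lambda>x. D * exp (- sqrt \<omega> * x)) \<longlongrightarrow> 0) at_top" by real_asymp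
  then show ?thesis
    by (rule tendsto_sandwich[OF _ _ tendsto_const, rotated 2])
      (use D \<phi>_pos in \<open>auto intro!: always_eventually less_imp_le\<close>)
qed

lemma \<phi>'_abs_le: "\<bar>\<phi>' x\<bar> \<le> sqrt \<omega> * \<phi> x"
proof -
  have "\<bar>\<phi>' x\<bar> = \<bar>T x\<bar> * (sqrt \<omega> * \<phi> x)"
    using \<phi>_pos[of x] \<omega>_pos by (simp add: \<phi>'_def abs_mult)
  also have "\<dots> \<le> 1 * (sqrt \<omega> * \<phi> x)"
    using \<phi>_pos[of x] \<omega>_pos T_abs_le by (intro mult_right_mono) auto
  finally show ?thesis by simp
qed

lemma \<phi>_primitive_pair:
  "primitive_pair (\<lambda>x. complex_of_real (\<phi> x)) (\<lambda>x. complex_of_real (\<phi>' x))"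
proof -
  obtain D where D: "\<And>x. \<phi> x \<le> D * exp (- sqrt \<omega> * x)" using \<phi>_decay by blast
  have s: "sqrt \<omega> > 0" using \<omega>_pos by simp
  have 1: "(\<lambda>x. complex_of_real (\<phi> x)) \<in> L2_half"
    by (rule exponential_decay_L2_half[OF \<phi>_continuous s, of D]) (use D \<phi>_pos less_imp_le in \<open>simp add: abs_of_pos\<close>)
  have 2: "(\<lambda>x. complex_of_real (\<phi>' x)) \<in> L2_half"
  proof (rule exponential_decay_L2_half[OF \<phi>'_continuous s, of "sqrt \<omega> * D"])
    fix x
    have "\<bar>\<phi>' x\<bar> \<le> sqrt \<omega> * (D * exp (- sqrt \<omega> * x))"
      using \<phi>'_abs_le[of x] mult_left_mono[OF D[of x], of "sqrt \<omega>"] s by linarith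
    then show "\<bar>\<phi>' x\<bar> \<le> sqrt \<omega> * D * exp (- sqrt \<omega> * x)" by simp
  qed
  have 3: "complex_of_real (\<phi> y) - complex_of_real (\<phi> x) = integral {x..y} (\<lambda>x. complex_of_real (\<phi>' x))"
    if "x \<le> y" for x y
  proof -
    have "(\<phi>' has_integral \<phi> y - \<phi> x) {x..y}"
      using that \<phi>_DERIV by (intro fundamental_theorem_of_calculus)
        (auto simp: has_real_derivative_iff_has_vector_derivative[symmetric] intro: DERIV_subset)
    from has_integral_linear[OF this bounded_linear_of_real[where 'a = complex]]
    show ?thesis by (simp add: comp_def integral_unique)
  qed
  have 4: "continuous_on {0..} (\<lambda>x. complex_of_real (\<phi> x))"
    by (intro continuous_intros \<phi>_continuous)
  show ?thesis unfolding primitive_pair_def using 1 2 3 4 by blast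
qed

lemma \<phi>_integrable:
  "integrable half_line (\<lambda>x. (\<phi>' x)\<^sup>2)" "integrable half_line (\<lambda>x. (\<phi> x)\<^sup>2)"
  "integrable half_line (\<lambda>x. \<phi> x powr (p + 1))"
  using \<phi>_primitive_pair primitive_pair_powr_integrable[OF \<phi>_primitive_pair, of "p + 1"] p \<phi>_pos[THEN less_imp_le]
  by (auto simp: primitive_pair_def L2_half_def)

text \<open>
  As \<open>w \<phi> = |\<phi>'|\<close>, the integrand is the derivative of \<open>\<plusminus> G \<phi>\<close>, with the sign of \<open>\<phi>'\<close>. The profile
  increases up to \<open>x1\<close> and decreases afterwards; when \<open>\<gamma> < 0\<close> the increasing part is absent and \<open>x1 = 0\<close>.
\<close>

lemma \<phi>_kinetic_energy: "(LINT x|half_line. (\<phi>' x)\<^sup>2) = half_energy"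
proof -
  define x1 where "x1 = max 0 (c / \<alpha>)"
  have x1: "x1 \<ge> 0" "\<alpha> * x1 \<ge> c"
    using \<alpha>_pos by (auto simp: x1_def max_def field_simps)
  have D: "((\<lambda>x. G (\<phi> x)) has_real_derivative \<bar>\<phi>' x\<bar> * \<phi>' x) (at x)" for x
    using DERIV_chain2[OF G_DERIV \<phi>_DERIV] by (simp add: w_\<phi>)
  have G0: "((\<lambda>x. G (\<phi> x)) \<longlongrightarrow> 0) at_top"
    using isCont_tendsto_compose[OF G_isCont[of 0] \<phi>_tendsto_0] by (simp add: G_0)
  have ai: "(\<lambda>x. (\<phi>' x)\<^sup>2) absolutely_integrable_on {0<..}"
    using \<phi>_integrable(1) by (simp add: integrable_half_line_iff)
  have A: "integral {x1<..} (\<lambda>x. (\<phi>' x)\<^sup>2) = - 0 - (- G (\<phi> x1))"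
  proof (rule half_line_integral_from[OF \<phi>_integrable(1) x1(1)])
    show "((\<lambda>x. - G (\<phi> x)) \<longlongrightarrow> - 0) at_top" by (intro tendsto_minus G0)
    fix x assume "x \<ge> x1"
    then have "\<alpha> * x \<ge> c" using x1(2) \<alpha>_pos by (smt (verit) mult_left_mono)
    then have "\<phi>' x \<le> 0" using T_sign(1)[of x] \<phi>_pos[of x] \<omega>_pos
      by (simp add: \<phi>'_def mult_nonneg_nonneg)
    then show "((\<lambda>x. - G (\<phi> x)) has_real_derivative (\<phi>' x)\<^sup>2) (at x)"
      using DERIV_minus[OF D[of x]] by (simp add: power2_eq_square)
  qed
  have B: "((\<lambda>x. (\<phi>' x)\<^sup>2) has_integral G (\<phi> x1) - G (\<phi> 0)) {0..x1}"
  proof (cases "c \<ge> 0")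
    case True
    show ?thesis
    proof (rule fundamental_theorem_of_calculus[OF x1(1)])
      fix x assume x: "x \<in> {0..x1}"
      then have "x \<le> c / \<alpha>" using True \<alpha>_pos by (simp add: x1_def)
      then have "\<alpha> * x \<le> c" using \<alpha>_pos by (simp add: field_simps)
      then have "\<phi>' x \<ge> 0" using T_sign(2)[of x] \<phi>_pos[of x] \<omega>_pos
        by (simp add: \<phi>'_def mult_nonneg_nonpos mult_nonpos_nonneg)
      then show "((\<lambda>x. G (\<phi> x)) has_vector_derivative (\<phi>' x)\<^sup>2) (at x within {0..x1})"
        using D[of x] by (simp add: power2_eq_square has_real_derivative_iff_has_vector_derivative[symmetric] has_field_derivative_at_within)
    qed
  next
    case False
    then have "c / \<alpha> < 0" using \<alpha>_pos by (simp add: divide_neg_pos)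
    then have "x1 = 0" by (simp add: x1_def)
    then show ?thesis using has_integral_refl(2)[of "\<lambda>x. (\<phi>' x)\<^sup>2" 0] by simp
  qed
  have B': "((\<lambda>x. (\<phi>' x)\<^sup>2) has_integral G (\<phi> x1) - G (\<phi> 0)) {0<..x1}"
    using B by (simp add: has_integral_Ioc_iff_Icc)
  have "(\<lambda>x. (\<phi>' x)\<^sup>2) absolutely_integrable_on {x1<..}"
    by (rule set_integrable_subset[OF ai]) (use x1 in auto)
  then have A': "((\<lambda>x. (\<phi>' x)\<^sup>2) has_integral G (\<phi> x1)) {x1<..}"
    using A by (simp add: has_integral_iff absolutely_integrable_on_def)
  have "((\<lambda>x. (\<phi>' x)\<^sup>2) has_integral G (\<phi> x1) - G (\<phi> 0) + G (\<phi> x1)) ({0<..x1} \<union> {x1<..})"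
  proof (rule has_integral_Un[OF B' A'])
    have "{0<..x1} \<inter> {x1<..} = {}" by auto
    then show "negligible ({0<..x1} \<inter> {x1<..})" by simp
  qed
  also have "{0<..x1} \<union> {x1<..} = {0<..}" using x1 by auto
  finally have "integral {0<..} (\<lambda>x. (\<phi>' x)\<^sup>2) = 2 * G (\<phi> x1) - G \<phi>0"
    by (simp add: integral_unique \<phi>_0)
  moreover have "(LINT x|half_line. (\<phi>' x)\<^sup>2) = integral {0<..} (\<lambda>x. (\<phi>' x)\<^sup>2)"
    by (rule lebesgue_integral_eq_integral[OF \<phi>_integrable(1)]) simp
  moreover have "half_energy = 2 * G (\<phi> x1) - G \<phi>0"
  proof (cases "\<gamma> < 0")
    case True
    then have "T 0 > 0" using \<omega>_pos by (simp add: T_0 divide_neg_pos)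
    then have "c < 0" unfolding T_def by simp
    then have "c / \<alpha> < 0" using \<alpha>_pos by (simp add: divide_neg_pos)
    then have "x1 = 0" by (simp add: x1_def)
    then show ?thesis using True by (simp add: half_energy_def \<phi>_0)
  next
    case False
    then have "T 0 \<le> 0" using \<omega>_pos by (simp add: T_0)
    then have "c \<ge> 0" unfolding T_def by simp
    then have "\<alpha> * x1 = c" using \<alpha>_pos by (simp add: x1_def)
    then have "\<phi> x1 = U" by (simp add: \<phi>_def)
    then show ?thesis using False by (simp add: half_energy_def)
  qed
  ultimately show ?thesis by simp
qed

text \<open>
  The density of the integral part of the Nehari functional is \<open>(\<phi>' \<phi>)'\<close>, by the equation \<open>\<phi>'' = \<omega> \<phi> - \<phi> powr p\<close>. Its
  integral \<open>- \<phi>'(0) \<phi>(0) = - \<gamma> \<phi>0\<^sup>2\<close> cancels the boundary term.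
\<close>

lemma \<phi>_nehari: "half_nehari p \<gamma> \<omega> (\<lambda>x. complex_of_real (\<phi> x)) (\<lambda>x. complex_of_real (\<phi>' x)) = 0"
proof -
  define f where "f x = (\<phi>' x)\<^sup>2 + \<omega> * (\<phi> x)\<^sup>2 - \<phi> x powr (p + 1)" for x
  have i: "integrable half_line f" unfolding f_def using \<phi>_integrable by auto
  have "integral {0<..} f = 0 - \<phi>' 0 * \<phi> 0"
  proof (rule half_line_integral_from[OF i order_refl])
    show "((\<lambda>x. \<phi>' x * \<phi> x) \<longlongrightarrow> 0) at_top"
    proof (rule Lim_null_comparison)
      show "((\<lambda>x. sqrt \<omega> * (\<phi> x)\<^sup>2) \<longlongrightarrow> 0) at_top"
        using tendsto_mult[OF tendsto_const[of "sqrt \<omega>"] tendsto_power[OF \<phi>_tendsto_0, of 2]] by simp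
      show "\<forall>\<^sub>F x in at_top. norm (\<phi>' x * \<phi> x) \<le> sqrt \<omega> * (\<phi> x)\<^sup>2"
      proof (rule always_eventually, rule allI)
        fix x
        show "norm (\<phi>' x * \<phi> x) \<le> sqrt \<omega> * (\<phi> x)\<^sup>2"
          using mult_right_mono[OF \<phi>'_abs_le[of x] less_imp_le[OF \<phi>_pos[of x]]] \<phi>_pos[of x]
          by (simp add: abs_mult power2_eq_square mult.assoc)
      qed
    qed
    fix x
    have P: "\<phi> x powr (p + 1) = (\<phi> x)\<^sup>2 * ((p + 1) / 2 * \<omega> * (1 - (T x)\<^sup>2))"
    proof -
      have "\<phi> x powr (p + 1) = \<phi> x powr 2 * \<phi> x powr (p - 1)"
        by (simp add: powr_add[symmetric] add.commute)
      then show ?thesis using \<phi>_pos[of x] by (simp add: \<phi>_powr)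
    qed
    have "((\<lambda>x. \<phi>' x * \<phi> x) has_real_derivative
        - sqrt \<omega> * (\<alpha> * (1 - (T x)\<^sup>2) * \<phi> x + \<phi>' x * T x) * \<phi> x + \<phi>' x * \<phi>' x) (at x)"
      using DERIV_mult[OF \<phi>'_DERIV \<phi>_DERIV, of x] by simp
    also have "- sqrt \<omega> * (\<alpha> * (1 - (T x)\<^sup>2) * \<phi> x + \<phi>' x * T x) * \<phi> x + \<phi>' x * \<phi>' x = f x"
    proof -
      have ss: "sqrt \<omega> * sqrt \<omega> = \<omega>" using \<omega>_pos by simp
      have sa: "sqrt \<omega> * \<alpha> = (p - 1) / 2 * \<omega>" using ss by (simp add: \<alpha>_def)
      have p1: "sqrt \<omega> * \<phi>' x = - (\<omega> * (T x * \<phi> x))" using ss by (simp add: \<phi>'_def mult.assoc[symmetric])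
      have p2: "\<phi>' x * \<phi>' x = \<omega> * ((T x)\<^sup>2 * (\<phi> x)\<^sup>2)"
        using ss by (simp add: \<phi>'_def power2_eq_square mult_ac) 
      have "- sqrt \<omega> * (\<alpha> * (1 - (T x)\<^sup>2) * \<phi> x + \<phi>' x * T x) * \<phi> x + \<phi>' x * \<phi>' x
        = - (sqrt \<omega> * \<alpha>) * (1 - (T x)\<^sup>2) * (\<phi> x)\<^sup>2 - (sqrt \<omega> * \<phi>' x) * T x * \<phi> x + \<phi>' x * \<phi>' x"
        by (simp add: algebra_simps power2_eq_square)
      also have "\<dots> = f x"
        unfolding sa p1 f_def P power2_eq_square[of "\<phi>' x"] p2 by (simp add: field_simps power2_eq_square)
      finally show ?thesis .
    qed
    finally show "((\<lambda>x. \<phi>' x * \<phi> x) has_real_derivative f x) (at x)" .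
  qed
  moreover have "(LINT x|half_line. f x) = integral {0<..} f"
    by (rule lebesgue_integral_eq_integral[OF i]) simp
  moreover have "(LINT x|half_line. f x) = (LINT x|half_line. (\<phi>' x)\<^sup>2) + \<omega> * (LINT x|half_line. (\<phi> x)\<^sup>2)
      - (LINT x|half_line. \<phi> x powr (p + 1))"
    unfolding f_def using \<phi>_integrable by simp
  ultimately show ?thesis
    using \<phi>_pos[THEN less_imp_le] by (simp add: half_nehari_def \<phi>_0 \<phi>'_0 power2_eq_square \<phi>0_pos less_imp_le)
qed

text \<open>
  Since \<open>W \<phi> = (\<phi>')\<^sup>2\<close>, the integral part of the action is \<open>\<integral> (\<phi>')\<^sup>2\<close>.
\<close>

lemma \<phi>_action: "half_action p \<gamma> \<omega> (\<lambda>x. complex_of_real (\<phi> x)) (\<lambda>x. complex_of_real (\<phi>' x))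
    = half_energy + \<gamma> / 2 * \<phi>0\<^sup>2"
proof -
  have "(\<phi>' x)\<^sup>2 = \<omega> * (\<phi> x)\<^sup>2 - 2 / (p + 1) * \<phi> x powr (p + 1)" for x
    using W_\<phi>[of x] \<phi>_pos[of x] by (simp add: W_def)
  then have "half_energy = (LINT x|half_line. \<omega> * (\<phi> x)\<^sup>2 - 2 / (p + 1) * \<phi> x powr (p + 1))"
    using \<phi>_kinetic_energy by simp
  also have "\<dots> = \<omega> * (LINT x|half_line. (\<phi> x)\<^sup>2) - 2 / (p + 1) * (LINT x|half_line. \<phi> x powr (p + 1))"
    using \<phi>_integrable by simp
  finally show ?thesis
    using \<phi>_pos[THEN less_imp_le] \<phi>_kinetic_energy
    by (simp add: half_action_def \<phi>_0 algebra_simps)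
qed

lemma \<phi>_eq_sech:
  "((p + 1) * \<omega> / 2 * (sech ((p - 1) * sqrt \<omega> / 2 * x - artanh (\<gamma> / sqrt \<omega>)))\<^sup>2) powr (1 / (p - 1)) = \<phi> x"
proof -
  have C: "cosh (\<alpha> * x - c) > 0" by simp
  have "((p + 1) * \<omega> / 2 * (sech (\<alpha> * x - c))\<^sup>2) = (p + 1) / 2 * \<omega> * cosh (\<alpha> * x - c) powr (- 2)"
    using C by (simp add: sech_def powr_minus power_divide inverse_eq_divide)
  also have "\<dots> powr (1 / (p - 1)) = \<phi> x"
  proof -
    have e: "- 2 * (1 / (p - 1)) = - 2 / (p - 1)" by simp
    show ?thesis unfolding powr_mult[of "(p + 1) / 2 * \<omega>"] powr_powr e \<phi>_def U_def ..
  qed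
  finally show ?thesis by (simp add: \<alpha>_def c_def)
qed

end

section \<open>Reduction to one edge\<close>

lemma primitive_pair_weak_deriv:
  assumes "primitive_pair u g" shows "has_weak_deriv u g" "u \<in> H1_half"
proof -
  have "u \<in> L2_half" "g \<in> L2_half" using assms by (auto simp: primitive_pair_def)
  moreover show "has_weak_deriv u g"
    by (rule primitive_has_weak_deriv) (use assms in \<open>auto simp: primitive_pair_def L2_half_locally_integrable\<close>)
  ultimately show "u \<in> H1_half" by (auto simp: H1_half_def)
qed

lemma H1_half_primitive_pair:
  assumes "f \<in> H1_half"
  obtains u g where "primitive_pair u g" "AE x in half_line. f x = u x"
proof -
  have f: "f \<in> L2_half" using assms by (simp add: H1_half_def)
  note wd = weak_deriv_properties[OF assms]
  obtain u where u: "continuous_on {0..} u" "AE x in half_line. f x = u x"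
    "\<And>x y. \<lbrakk>0 \<le> x; x \<le> y\<rbrakk> \<Longrightarrow> u y - u x = integral {x..y} (weak_deriv f)"
    using H1_representative[OF f wd] by blast
  have um: "u \<in> borel_measurable half_line"
  proof (rule continuous_imp_measurable_on_sets_lebesgue)
    show "continuous_on {0<..} u" by (rule continuous_on_subset[OF u(1)]) auto
  qed auto
  have "integrable half_line (\<lambda>x. (cmod (u x))\<^sup>2)"
  proof (rule integrable_cong_AE_imp)
    show "integrable half_line (\<lambda>x. (cmod (f x))\<^sup>2)" using f by (simp add: L2_half_def)
    show "(\<lambda>x. (cmod (u x))\<^sup>2) \<in> borel_measurable half_line" using um by measurable
    show "AE x in half_line. (cmod (f x))\<^sup>2 = (cmod (u x))\<^sup>2" using u(2) by eventually_elim simp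
  qed
  then have "u \<in> L2_half" using um by (simp add: L2_half_def)
  then have "primitive_pair u (weak_deriv f)"
    using u wd by (simp add: primitive_pair_def)
  then show ?thesis using that u(2) by blast
qed

lemma star_norm_equal_edges:
  assumes q: "q > 0" and m: "\<And>j. j \<in> {1..N} \<Longrightarrow> v j \<in> borel_measurable half_line" "h \<in> borel_measurable half_line"
    and eq: "\<And>j. j \<in> {1..N} \<Longrightarrow> AE x in half_line. v j x = h x"
  shows "star_norm N q v powr q = N * (LINT x|half_line. cmod (h x) powr q)"
    and "star_norm N q v \<ge> 0"
proof -
  have "(LINT x|half_line. cmod (v j x) powr q) = (LINT x|half_line. cmod (h x) powr q)" if "j \<in> {1..N}" for j
  proof (rule integral_cong_AE)
    show "AE x in half_line. cmod (v j x) powr q = cmod (h x) powr q"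
      using eq[OF that] by eventually_elim simp
    show "(\<lambda>x. cmod (v j x) powr q) \<in> borel_measurable half_line" using m(1)[OF that] by measurable
    show "(\<lambda>x. cmod (h x) powr q) \<in> borel_measurable half_line" using m(2) by measurable
  qed
  then have s: "(\<Sum>j=1..N. LINT x|half_line. cmod (v j x) powr q) = N * (LINT x|half_line. cmod (h x) powr q)"
    by simp
  have "(LINT x|half_line. cmod (h x) powr q) \<ge> 0"
    by (rule Bochner_Integration.integral_nonneg) simp
  then show "star_norm N q v powr q = N * (LINT x|half_line. cmod (h x) powr q)"
    unfolding star_norm_def s powr_powr using q by simp
  show "star_norm N q v \<ge> 0" by (simp add: star_norm_def)
qed

text \<open>
  The edges differ from \<open>u\<close> only on null sets. The sum of the traces is squared, hence the boundary term
  \<open>N\<^sup>2 |u(0)|\<^sup>2 / \<beta>\<close>, and dividing by \<open>N\<close> turns the coefficient into \<open>N / \<beta>\<close>.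
\<close>

lemma equal_edges_reduction:
  assumes N: "N \<ge> 1" and v: "v \<in> H1_eq N" and pp: "primitive_pair u g" and eq: "AE x in half_line. v 1 x = u x"
    and p: "p > 1"
  shows "S_star N p \<beta> \<omega> v = N * half_action p (N / \<beta>) \<omega> u g"
    and "I_star N p \<beta> \<omega> v = N * half_nehari p (N / \<beta>) \<omega> u g"
    and "star_zero N v \<longleftrightarrow> (\<forall>x\<ge>0. u x = 0)"
proof -
  have u: "continuous_on {0..} u" "u \<in> L2_half" and gL: "g \<in> L2_half" using pp by (auto simp: primitive_pair_def)
  have vj: "v j \<in> H1_half" if "j \<in> {1..N}" for j using v that by (auto simp: H1_eq_def H1_star_def)
  have vL: "v j \<in> L2_half" if "j \<in> {1..N}" for j using vj[OF that] by (simp add: H1_half_def)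
  have vu: "AE x in half_line. v j x = u x" if "j \<in> {1..N}" for j
  proof -
    have "AE x in half_line. v j x = v 1 x" using v that N by (auto simp: H1_eq_def)
    then show ?thesis using eq by eventually_elim simp
  qed
  have wg: "AE x in half_line. weak_deriv (v j) x = g x" if "j \<in> {1..N}" for j
  proof (rule weak_deriv_unique[OF weak_deriv_properties(2)[OF vj[OF that]] _ weak_deriv_properties(1)[OF vj[OF that]] gL])
    have "AE x in half_line. u x = v j x" using vu[OF that] by eventually_elim simp
    then show "has_weak_deriv (v j) g"
      by (rule has_weak_deriv_cong_AE[OF _ u(2) vL[OF that] primitive_pair_weak_deriv(1)[OF pp]])
  qed
  have tr: "trace0 (v j) = u 0" if "j \<in> {1..N}" for j
    by (rule trace0_eqI[OF u(1) vu[OF that]])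
  have wL: "weak_deriv (v j) \<in> L2_half" if "j \<in> {1..N}" for j
    by (rule weak_deriv_properties(1)[OF vj[OF that]])
  note L = L2_half_def[THEN eqset_imp_iff, THEN iffD1, simplified, THEN conjunct1]
  have n1: "(star_norm N 2 (\<lambda>j. weak_deriv (v j)))\<^sup>2 = N * (LINT x|half_line. (cmod (g x))\<^sup>2)"
    using star_norm_equal_edges[of 2 N "\<lambda>j. weak_deriv (v j)" g, OF _ L[OF wL] L[OF gL] wg] by simp
  have n2: "(star_norm N 2 v)\<^sup>2 = N * (LINT x|half_line. (cmod (u x))\<^sup>2)"
    using star_norm_equal_edges[of 2 N v u, OF _ L[OF vL] L[OF u(2)] vu] by simp
  have n3: "star_norm N (p + 1) v powr (p + 1) = N * (LINT x|half_line. cmod (u x) powr (p + 1))"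
    using star_norm_equal_edges(1)[of "p + 1" N v u, OF _ L[OF vL] L[OF u(2)] vu] p by simp
  have t: "(cmod (\<Sum>j=1..N. trace0 (v j)))\<^sup>2 = N * N * (cmod (u 0))\<^sup>2"
    using tr by (simp add: norm_mult power_mult_distrib power2_eq_square)
  have F: "F_star N \<beta> v = N * ((LINT x|half_line. (cmod (g x))\<^sup>2) + N / \<beta> * (cmod (u 0))\<^sup>2)"
    unfolding F_star_def n1 t by (simp add: algebra_simps)
  show "S_star N p \<beta> \<omega> v = N * half_action p (N / \<beta>) \<omega> u g"
    unfolding S_star_def F n2 n3 half_action_def by (simp add: algebra_simps)
  show "I_star N p \<beta> \<omega> v = N * half_nehari p (N / \<beta>) \<omega> u g"
    unfolding I_star_def F n2 n3 half_nehari_def by (simp add: algebra_simps)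
  show "star_zero N v \<longleftrightarrow> (\<forall>x\<ge>0. u x = 0)"
  proof
    assume "star_zero N v"
    then have "AE x in half_line. v 1 x = 0" using N by (simp add: star_zero_def)
    then have "AE x in half_line. u x = 0" using eq by eventually_elim simp
    then show "\<forall>x\<ge>0. u x = 0"
      using AE_eq_continuous_imp_eq[OF u(1) continuous_on_const, of 0] by blast
  next
    assume z: "\<forall>x\<ge>0. u x = 0"
    show "star_zero N v"
      unfolding star_zero_def
    proof
      fix j assume "j \<in> {1..N}"
      have "AE x in half_line. x \<in> space half_line" by (rule AE_space)
      then show "AE x in half_line. v j x = 0" using vu[OF \<open>j \<in> {1..N}\<close>]
        by eventually_elim (use z in auto)
    qed
  qed
qed

theorem lemma3p3:
  fixes N :: nat and p \<beta> \<omega> :: real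
  assumes "N \<ge> 2" and "p > 1" and "\<beta> \<noteq> 0" and "\<omega> > (real N)\<^sup>2 / \<beta>\<^sup>2"
  shows "d_eq N p \<beta> \<omega> = ereal (S_star N p \<beta> \<omega> (phi_star N p \<beta> \<omega>))"
proof -
  define \<gamma> where "\<gamma> = N / \<beta>"
  interpret delta_soliton p \<gamma> \<omega>
    using assms by unfold_locales (auto simp: \<gamma>_def power_divide)
  have N: "N \<ge> 1" using assms by simp
  define \<Phi> where "\<Phi> = phi_star N p \<beta> \<omega>"
  have \<Phi>: "\<Phi> j = (\<lambda>x. complex_of_real (\<phi> x))" for j
    using \<phi>_eq_sech by (simp add: \<Phi>_def phi_star_def phi_tilde_def \<gamma>_def)
  have \<Phi>_H1: "\<Phi> \<in> H1_eq N"
    using primitive_pair_weak_deriv(2)[OF \<phi>_primitive_pair] by (simp add: H1_eq_def H1_star_def \<Phi>)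
  have "AE x in half_line. \<Phi> 1 x = complex_of_real (\<phi> x)" by (simp add: \<Phi>)
  note red\<Phi>_all = equal_edges_reduction[OF N \<Phi>_H1 \<phi>_primitive_pair this assms(2)]
  note red\<Phi> = red\<Phi>_all(1,2)[of \<beta>, folded \<gamma>_def] red\<Phi>_all(3)
  have S\<Phi>: "S_star N p \<beta> \<omega> \<Phi> = N * (half_energy + \<gamma> / 2 * \<phi>0\<^sup>2)"
    by (simp add: red\<Phi>(1) \<phi>_action)
  have I\<Phi>: "I_star N p \<beta> \<omega> \<Phi> = 0" by (simp add: red\<Phi>(2) \<phi>_nehari)
  have nz\<Phi>: "\<not> star_zero N \<Phi>"
    unfolding red\<Phi>(3) using \<phi>_pos[of 0] by force
  have "S_star N p \<beta> \<omega> \<Phi> \<le> S_star N p \<beta> \<omega> v"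
    if v: "v \<in> H1_eq N" "\<not> star_zero N v" "I_star N p \<beta> \<omega> v = 0" for v
  proof -
    have "v 1 \<in> H1_half" using v(1) N by (simp add: H1_eq_def H1_star_def)
    then obtain u g where ug: "primitive_pair u g" "AE x in half_line. v 1 x = u x"
      using H1_half_primitive_pair by blast
    note red_all = equal_edges_reduction[OF N v(1) ug assms(2)]
    note red = red_all(1,2)[of \<beta>, folded \<gamma>_def] red_all(3)
    obtain x0 where "x0 \<ge> 0" "u x0 \<noteq> 0" using v(2) red(3) by blast
    moreover have "half_nehari p \<gamma> \<omega> u g = 0" using v(3) red(2) N by simp
    ultimately have "half_energy + \<gamma> / 2 * \<phi>0\<^sup>2 \<le> half_action p \<gamma> \<omega> u g"
      using half_action_lower_bound[OF ug(1)] by blast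
    then show ?thesis unfolding S\<Phi> red(1) by (intro mult_left_mono) auto
  qed
  then show ?thesis
    unfolding d_eq_def \<Phi>_def[symmetric] using \<Phi>_H1 I\<Phi> nz\<Phi>
    by (intro antisym INF_lower INF_greatest) auto
qed

end
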